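(* Let $\mathcal{P}$ be a smooth hypergraph property with $d(\mathcal{P})=r$, let $H$ be a non-empty hypergraph, and let $L$ be a list-assignment for $H$ such that $H$ is $(\mathcal{P},L)$-critical and the low-vertex hypergraph $F=H(V(H,\mathcal{P},L))$ is non-empty. Then every block $B$ of $F$ satisfies one of the following: $B$ is a brick; or $B\in\mathcal{F}(\mathcal{P})$ and $B$ is $r$-regular; or $B\in\mathcal{P}$ and $\Delta(B)\le r$.
   Context: A hypergraph is a triple $H=(V,E,i)$ with $V,E$ finite sets and $i:E\to 2^V$ satisfying $|i(e)|\ge 2$ for every $e\in E$ (parallel edges allowed); $V(H)=V$, $E(H)=E$, $i_H=i$. The empty hypergraph has $V=E=\varnothing$. For $X\subseteq V(H)$, the induced subhypergraph $H[X]$ has vertex set $X$ and edge set $\{e: i_H(e)\subseteq X\}$ with the restricted incidence function; $H-v=H[V(H)\setminus\{v\}]$. The shrinking $H(X)$ is the hypergraph with vertex set $X$, edge set $\{e\in E(H): |i_H(e)\cap X|\ge 2\}$ and incidence $e\mapsto i_H(e)\cap X$. The degree $d_H(v)$ is the number of edges $e$ with $v\in i_H(e)$; $\delta(H),\Delta(H)$ are the minimum and maximum degree ($0$ for the empty hypergraph); $H$ is $r$-regular if every vertex has degree $r$. A hyperpath is an alternating sequence of distinct vertices and distinct edges $v_1,e_1,v_2,\dots,e_q,v_{q+1}$ with $\{v_j,v_{j+1}\}\subseteq i_H(e_j)$; $H$ is connected if any two vertices are joined by a hyperpath. A separating vertex of $H$ is a vertex $v$ such that $H$ is the union of two induced subhypergraphs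 $H_1,H_2$ with $V(H_1)\cap V(H_2)=\{v\}$ and $|V(H_i)|\ge 2$. A block is a maximal connected subhypergraph without a separating vertex. $K_n$ denotes the complete (simple) graph on $n$ vertices and $C_n$ the cycle on $n$ vertices consisting of edges of size $2$; for a simple hypergraph $G$ and $t\ge1$, $tG$ is obtained by replacing every edge by $t$ parallel edges. A brick is a hypergraph of the form $tC_n$ with $t\ge1$ and $n\ge3$ odd, or $tK_n$ with $t,n\ge 1$. A hypergraph property is a class of hypergraphs closed under isomorphism. It is smooth if it is hereditary (closed under induced subhypergraphs) and non-trivial (contains a non-empty hypergraph but not all hypergraphs). $\mathcal{F}(\mathcal{P})$ is the class of hypergraphs $H\notin\mathcal{P}$ with $H-v\in\mathcal{P}$ for all $v\in V(H)$, and $d(\mathcal{P})=\min\{\delta(H): H\in\mathcal{F}(\mathcal{P})\}$. A list-assignment for $H$ with color set $C$ is a map $L:V(H)\to 2^C$. A $(\mathcal{P},L)$-coloring of $H$ is a map $\varphi:V(H)\to C$ with $\varphi(v)\in L(v)$ for all $v$ and $H[\varphi^{-1}(c)]\in\mathcal{P}$ for all $c\in C$. $H$ is $(\mathcal{P},L)$-critical if $H$ has no $(\mathcal{P},L)$-coloring but $H-v$ has one for every $v\in V(H)$. For such $H$ with $r=d(\mathcal{P})$, $V(H,\mathcal{P},L)=\{v\in V(H): d_H(v)=r|L(v)|\}$ (the low vertices). *)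

theory Defs
  imports Main "HOL-Library.Infinite_Typeclass"
begin

section \<open>Hypergraphs\<close>

text \<open>Only the values of \<open>inc\<close> on \<open>edges\<close> are meaningful, so record equality is finer than equality
  of hypergraphs; hypergraphs are compared below by \<open>subhypergraph\<close> and \<open>hyper_iso\<close>.\<close>

record ('v, 'e) hypergraph =
  verts :: "'v set"
  edges :: "'e set"
  inc :: "'e \<Rightarrow> 'v set"

definition hypergraph :: "('v, 'e) hypergraph \<Rightarrow> bool" where
  "hypergraph H \<longleftrightarrow> finite (verts H) \<and> finite (edges H) \<and>
     (\<forall>e\<in>edges H. inc H e \<subseteq> verts H \<and> card (inc H e) \<ge> 2)"

definition hyper_iso :: "('v, 'e) hypergraph \<Rightarrow> ('w, 'f) hypergraph \<Rightarrow> bool" where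
  "hyper_iso G H \<longleftrightarrow> (\<exists>f g. bij_betw f (verts G) (verts H) \<and> bij_betw g (edges G) (edges H) \<and>
     (\<forall>e\<in>edges G. inc H (g e) = f ` inc G e))"

definition subhypergraph :: "('v, 'e) hypergraph \<Rightarrow> ('v, 'e) hypergraph \<Rightarrow> bool" where
  "subhypergraph G H \<longleftrightarrow> hypergraph G \<and> verts G \<subseteq> verts H \<and> edges G \<subseteq> edges H \<and>
     (\<forall>e\<in>edges G. inc G e = inc H e)"

definition induced :: "('v, 'e) hypergraph \<Rightarrow> 'v set \<Rightarrow> ('v, 'e) hypergraph" where
  "induced H X = \<lparr>verts = X, edges = {e \<in> edges H. inc H e \<subseteq> X}, inc = inc H\<rparr>"

definition del_vert :: "('v, 'e) hypergraph \<Rightarrow> 'v \<Rightarrow> ('v, 'e) hypergraph" where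
  "del_vert H v = induced H (verts H - {v})"

definition shrinking :: "('v, 'e) hypergraph \<Rightarrow> 'v set \<Rightarrow> ('v, 'e) hypergraph" where
  "shrinking H X = \<lparr>verts = X, edges = {e \<in> edges H. card (inc H e \<inter> X) \<ge> 2},
     inc = (\<lambda>e. inc H e \<inter> X)\<rparr>"

definition degree :: "('v, 'e) hypergraph \<Rightarrow> 'v \<Rightarrow> nat" where
  "degree H v = card {e \<in> edges H. v \<in> inc H e}"

definition min_degree :: "('v, 'e) hypergraph \<Rightarrow> nat" where
  "min_degree H = (if verts H = {} then 0 else Min (degree H ` verts H))"

definition max_degree :: "('v, 'e) hypergraph \<Rightarrow> nat" where
  "max_degree H = (if verts H = {} then 0 else Max (degree H ` verts H))"

definition regular :: "nat \<Rightarrow> ('v, 'e) hypergraph \<Rightarrow> bool" where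
  "regular r H \<longleftrightarrow> (\<forall>v\<in>verts H. degree H v = r)"

section \<open>Connectivity and blocks\<close>

definition hyperpath :: "('v, 'e) hypergraph \<Rightarrow> 'v list \<Rightarrow> 'e list \<Rightarrow> bool" where
  "hyperpath H vs es \<longleftrightarrow> length vs = length es + 1 \<and> distinct vs \<and> distinct es \<and>
     set vs \<subseteq> verts H \<and> set es \<subseteq> edges H \<and>
     (\<forall>j<length es. {vs ! j, vs ! (j + 1)} \<subseteq> inc H (es ! j))"

definition hyper_connected :: "('v, 'e) hypergraph \<Rightarrow> bool" where
  "hyper_connected H \<longleftrightarrow>
     (\<forall>u\<in>verts H. \<forall>v\<in>verts H. \<exists>vs es. hyperpath H vs es \<and> hd vs = u \<and> last vs = v)"

definition separating_vertex :: "('v, 'e) hypergraph \<Rightarrow> 'v \<Rightarrow> bool" where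
  "separating_vertex H v \<longleftrightarrow> (\<exists>X Y. X \<subseteq> verts H \<and> Y \<subseteq> verts H \<and>
     verts H = verts (induced H X) \<union> verts (induced H Y) \<and>
     edges H = edges (induced H X) \<union> edges (induced H Y) \<and>
     X \<inter> Y = {v} \<and> card X \<ge> 2 \<and> card Y \<ge> 2)"

definition connected_nonseparable :: "('v, 'e) hypergraph \<Rightarrow> bool" where
  "connected_nonseparable H \<longleftrightarrow> hyper_connected H \<and> \<not> (\<exists>v\<in>verts H. separating_vertex H v)"

definition block :: "('v, 'e) hypergraph \<Rightarrow> ('v, 'e) hypergraph \<Rightarrow> bool" where
  "block H B \<longleftrightarrow> subhypergraph B H \<and> connected_nonseparable B \<and>
     (\<forall>B'. subhypergraph B' H \<and> connected_nonseparable B' \<and> subhypergraph B B' \<longrightarrow>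
        subhypergraph B' B)"

section \<open>Bricks\<close>

definition complete_graph :: "nat \<Rightarrow> (nat, nat set) hypergraph" where
  "complete_graph n = \<lparr>verts = {..<n}, edges = {e. e \<subseteq> {..<n} \<and> card e = 2}, inc = (\<lambda>e. e)\<rparr>"

text \<open>This is the cycle only if \<open>n \<ge> 3\<close>.\<close>

definition cycle_graph :: "nat \<Rightarrow> (nat, nat set) hypergraph" where
  "cycle_graph n = \<lparr>verts = {..<n}, edges = {{k, (k + 1) mod n} |k. k < n}, inc = (\<lambda>e. e)\<rparr>"

definition multiply_edges :: "nat \<Rightarrow> ('v, 'e) hypergraph \<Rightarrow> ('v, 'e \<times> nat) hypergraph" where
  "multiply_edges t G = \<lparr>verts = verts G, edges = edges G \<times> {..<t}, inc = (\<lambda>(e, k). inc G e)\<rparr>"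

definition brick :: "('v, 'e) hypergraph \<Rightarrow> bool" where
  "brick B \<longleftrightarrow>
     (\<exists>t n. t \<ge> 1 \<and> n \<ge> 3 \<and> odd n \<and> hyper_iso (multiply_edges t (cycle_graph n)) B) \<or>
     (\<exists>t n. t \<ge> 1 \<and> n \<ge> 1 \<and> hyper_iso (multiply_edges t (complete_graph n)) B)"

section \<open>Hypergraph properties\<close>

text \<open>A property is an isomorphism-closed set of hypergraphs over fixed vertex and edge types. These
  types are taken to be infinite, so that every finite hypergraph has an isomorphic copy over
  them and such sets correspond exactly to isomorphism-closed classes of hypergraphs.\<close>

definition hypergraph_property :: "('v::infinite, 'e::infinite) hypergraph set \<Rightarrow> bool" where
  "hypergraph_property P \<longleftrightarrow> (\<forall>H\<in>P. hypergraph H) \<and>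
     (\<forall>G H. G \<in> P \<and> hypergraph H \<and> hyper_iso G H \<longrightarrow> H \<in> P)"

definition hereditary :: "('v::infinite, 'e::infinite) hypergraph set \<Rightarrow> bool" where
  "hereditary P \<longleftrightarrow> (\<forall>H\<in>P. \<forall>X. X \<subseteq> verts H \<longrightarrow> induced H X \<in> P)"

definition nontrivial :: "('v::infinite, 'e::infinite) hypergraph set \<Rightarrow> bool" where
  "nontrivial P \<longleftrightarrow> (\<exists>H\<in>P. verts H \<noteq> {}) \<and> (\<exists>H. hypergraph H \<and> H \<notin> P)"

definition smooth :: "('v::infinite, 'e::infinite) hypergraph set \<Rightarrow> bool" where
  "smooth P \<longleftrightarrow> hypergraph_property P \<and> hereditary P \<and> nontrivial P"

definition minimal_forbidden ::
    "('v::infinite, 'e::infinite) hypergraph set \<Rightarrow> ('v, 'e) hypergraph set" where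
  "minimal_forbidden P = {H. hypergraph H \<and> H \<notin> P \<and> (\<forall>v\<in>verts H. del_vert H v \<in> P)}"

text \<open>For smooth \<open>P\<close> the set \<open>minimal_forbidden P\<close> is non-empty, so the infimum of these natural
  numbers is a minimum.\<close>

definition prop_degree :: "('v::infinite, 'e::infinite) hypergraph set \<Rightarrow> nat" where
  "prop_degree P = Inf (min_degree ` minimal_forbidden P)"

lemma smooth_minimal_forbidden_nonempty:
  assumes "smooth P"
  shows "minimal_forbidden P \<noteq> {}"
proof -
  obtain H0 where H0: "hypergraph H0" "H0 \<notin> P"
    using assms by (auto simp: smooth_def nontrivial_def)
  obtain H where H: "hypergraph H \<and> H \<notin> P"
    and min: "\<And>G. hypergraph G \<and> G \<notin> P \<Longrightarrow> card (verts H) \<le> card (verts G)"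
    using H0 ex_has_least_nat[of "\<lambda>H. hypergraph H \<and> H \<notin> P" H0 "\<lambda>H. card (verts H)"] by blast
  have "del_vert H v \<in> P" if v: "v \<in> verts H" for v
  proof (rule ccontr)
    assume "del_vert H v \<notin> P"
    moreover have "hypergraph (del_vert H v)"
      using H by (auto simp: hypergraph_def del_vert_def induced_def)
    ultimately have "card (verts H) \<le> card (verts H - {v})"
      using min[of "del_vert H v"] by (simp add: del_vert_def induced_def)
    moreover have "card (verts H - {v}) < card (verts H)"
      using H v card_Diff1_less[of "verts H" v] by (simp only: hypergraph_def)
    ultimately show False by simp
  qed
  then show ?thesis using H by (auto simp: minimal_forbidden_def)
qed

section \<open>List colorings\<close>

definition list_assignment :: "('v, 'e) hypergraph \<Rightarrow> 'c set \<Rightarrow> ('v \<Rightarrow> 'c set) \<Rightarrow> bool" where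
  "list_assignment H C L \<longleftrightarrow> (\<forall>v\<in>verts H. L v \<subseteq> C)"

definition list_coloring :: "('v::infinite, 'e::infinite) hypergraph set \<Rightarrow> 'c set \<Rightarrow>
    ('v \<Rightarrow> 'c set) \<Rightarrow> ('v, 'e) hypergraph \<Rightarrow> ('v \<Rightarrow> 'c) \<Rightarrow> bool" where
  "list_coloring P C L H \<phi> \<longleftrightarrow> (\<forall>v\<in>verts H. \<phi> v \<in> C \<and> \<phi> v \<in> L v) \<and>
     (\<forall>c\<in>C. induced H {v \<in> verts H. \<phi> v = c} \<in> P)"

definition list_critical :: "('v::infinite, 'e::infinite) hypergraph set \<Rightarrow> 'c set \<Rightarrow>
    ('v \<Rightarrow> 'c set) \<Rightarrow> ('v, 'e) hypergraph \<Rightarrow> bool" where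
  "list_critical P C L H \<longleftrightarrow> \<not> (\<exists>\<phi>. list_coloring P C L H \<phi>) \<and>
     (\<forall>v\<in>verts H. \<exists>\<phi>. list_coloring P C L (del_vert H v) \<phi>)"

text \<open>The color set may be infinite; the finiteness condition excludes lists for which \<open>card\<close> is
  \<open>0\<close> by convention.\<close>

definition low_vertices :: "('v::infinite, 'e::infinite) hypergraph set \<Rightarrow>
    ('v \<Rightarrow> 'c set) \<Rightarrow> ('v, 'e) hypergraph \<Rightarrow> 'v set" where
  "low_vertices P L H =
     {v \<in> verts H. finite (L v) \<and> degree H v = prop_degree P * card (L v)}"

end

theory Submission
  imports Defs "HOL-Number_Theory.Cong"
begin

text \<open>Color \<open>H - v\<close> for a low vertex \<open>v\<close>, the hole. By counting, every edge at \<open>v\<close> is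
  monochromatic apart from \<open>v\<close>, exactly \<open>r\<close> edges at \<open>v\<close> have any given color of \<open>L v\<close>, and the hole
  can be shifted to any low neighbor. Moving the hole only inside a block \<open>B\<close> fixes all colors outside
  \<open>B\<close>, so the number of edges of \<open>B\<close> of a given color seen from the hole depends only on the position
  of the hole, and it is at most \<open>r\<close>.

  If the hole always sees a single color, then all degrees in \<open>B\<close> are at most \<open>r\<close>, and since members of
  \<open>\<F>(\<P>)\<close> have minimum degree at least \<open>r\<close>, connectivity leaves only \<open>B \<in> \<P>\<close> or \<open>B \<in> \<F>(\<P>)\<close> regular.
  Otherwise a shortest path avoiding the hole between two differently colored neighbors closes up to an
  induced cycle. Rotating the colors of such a cycle once around shows that it is odd, alternately
  colored with two colors, and made of ordinary edges of constant multiplicity. If its length is at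
  least 5, sending the hole along an ear would break the alternation, so the cycle is all of \<open>B\<close>. If only
  triangles arise, rotations of triangles permute the colors around the hole freely enough to force \<open>B\<close>
  to be complete.\<close>

section \<open>Adjacency and induced cycles\<close>

definition adj :: "('v, 'e) hypergraph \<Rightarrow> 'v \<Rightarrow> 'v \<Rightarrow> bool" where
  "adj G u v \<longleftrightarrow> u \<noteq> v \<and> (\<exists>e\<in>edges G. u \<in> inc G e \<and> v \<in> inc G e)"

lemma adj_sym: "adj G u v \<Longrightarrow> adj G v u"
  by (auto simp: adj_def)

lemma adj_commute: "adj G u v \<longleftrightarrow> adj G v u"
  by (auto simp: adj_def)

lemma adj_irrefl [simp]: "\<not> adj G u u"
  by (simp add: adj_def)

lemma adj_verts: "hypergraph G \<Longrightarrow> adj G u v \<Longrightarrow> u \<in> verts G \<and> v \<in> verts G"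
  by (auto simp: adj_def hypergraph_def)

text \<open>This is adjacency in the shrinking to the vertices other than \<open>x\<close>: an edge
  through \<open>x\<close> still joins its remaining vertices, unlike in
  \<open>del_vert\<close>.\<close>

definition adj_avoiding :: "('v, 'e) hypergraph \<Rightarrow> 'v \<Rightarrow> 'v \<Rightarrow> 'v \<Rightarrow> bool" where
  "adj_avoiding G x u v \<longleftrightarrow> adj G u v \<and> u \<noteq> x \<and> v \<noteq> x"

definition pair_edges :: "('v, 'e) hypergraph \<Rightarrow> 'v \<Rightarrow> 'v \<Rightarrow> 'e set" where
  "pair_edges G u v = {e \<in> edges G. u \<in> inc G e \<and> v \<in> inc G e}"

lemma pair_edges_commute: "pair_edges G u v = pair_edges G v u"
  by (auto simp: pair_edges_def)

text \<open>Asking for some vertex of color \<open>c\<close> suffices: by the axiom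
  \<open>mono\<close> below, the vertices other than \<open>v\<close> of an edge at the hole
  \<open>v\<close> share one color.\<close>

definition colored_edges ::
    "('v, 'e) hypergraph \<Rightarrow> 'v \<Rightarrow> ('v \<Rightarrow> 'c) \<Rightarrow> 'c \<Rightarrow> 'e set" where
  "colored_edges G v \<phi> c = {e \<in> edges G. v \<in> inc G e \<and> (\<exists>u\<in>inc G e - {v}. \<phi> u = c)}"

text \<open>The index \<open>i\<close> is read modulo \<open>n\<close>, so that \<open>\<lambda>i. p (i + k)\<close> is again an induced cycle.\<close>

definition induced_cycle :: "('v, 'e) hypergraph \<Rightarrow> nat \<Rightarrow> (nat \<Rightarrow> 'v) \<Rightarrow> bool" where
  "induced_cycle G n p \<longleftrightarrow> n \<ge> 3 \<and> (\<forall>i j. p i = p j \<longleftrightarrow> [i = j] (mod n)) \<and>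
     (\<forall>i j. adj G (p i) (p j) \<longleftrightarrow> [Suc i = j] (mod n) \<or> [Suc j = i] (mod n))"

lemma induced_cycle_shift:
  assumes "induced_cycle G n p"
  shows "induced_cycle G n (\<lambda>i. p (i + k))"
  using assms unfolding induced_cycle_def
  by (simp add: cong_add_rcancel_nat flip: add_Suc)

lemma induced_cycle_step:
  assumes "induced_cycle G n p"
  shows "adj G (p i) (p (Suc i))"
  using assms by (simp add: induced_cycle_def)

lemma induced_cycle_periodic:
  assumes "induced_cycle G n p"
  shows "p (i + n) = p i"
  using assms unfolding induced_cycle_def by (simp add: cong_def)

lemma induced_cycle_eq_iff:
  assumes "induced_cycle G n p" "i < n" "j < n"
  shows "p i = p j \<longleftrightarrow> i = j"
  using assms unfolding induced_cycle_def by (simp add: cong_def)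

lemma induced_cycle_range:
  assumes "induced_cycle G n p"
  shows "range p = p ` {..<n}"
proof -
  have "p i = p (i mod n)" and "i mod n < n" for i
    using assms unfolding induced_cycle_def by (auto simp: cong_def)
  then show ?thesis by blast
qed

lemma induced_cycle_adj_start:
  assumes "induced_cycle G n p" and "adj G (p 0) (p j)" and "j < n"
  shows "j = 1 \<or> j = n - 1"
proof -
  have "[Suc 0 = j] (mod n) \<or> [Suc j = 0] (mod n)" and n: "n \<ge> 3"
    using assms unfolding induced_cycle_def by blast+
  then show ?thesis
    using assms(3) by (cases "Suc j = n") (auto simp: cong_def)
qed

lemma triangle_induced_cycle:
  assumes "adj G x y" "adj G y z" "adj G x z"
  shows "induced_cycle G 3 (\<lambda>i. if i mod 3 = 0 then x else if i mod 3 = 1 then y else z)"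
proof -
  have d: "x \<noteq> y" "y \<noteq> z" "x \<noteq> z" using assms by auto
  have a: "adj G y x" "adj G z y" "adj G z x" using assms by (auto intro: adj_sym)
  have m: "i mod 3 = 0 \<or> i mod 3 = 1 \<or> i mod 3 = 2" for i :: nat by linarith
  have s: "Suc i mod 3 = (if i mod 3 = 0 then 1 else if i mod 3 = 1 then 2 else 0)" for i
    using m[of i] by (auto simp: mod_Suc)
  show ?thesis
    unfolding induced_cycle_def cong_def s
  proof (intro conjI allI)
    fix i j :: nat
    show "((if i mod 3 = 0 then x else if i mod 3 = 1 then y else z) =
        (if j mod 3 = 0 then x else if j mod 3 = 1 then y else z)) = (i mod 3 = j mod 3)"
      using m[of i] m[of j] d by auto
    show "adj G (if i mod 3 = 0 then x else if i mod 3 = 1 then y else z)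
          (if j mod 3 = 0 then x else if j mod 3 = 1 then y else z) =
         ((if i mod 3 = 0 then 1 else if i mod 3 = 1 then 2 else 0) = j mod 3 \<or>
          (if j mod 3 = 0 then 1 else if j mod 3 = 1 then 2 else 0) = i mod 3)"
      using m[of i] m[of j] d a assms by auto
  qed simp
qed

text \<open>A shortest path from \<open>S\<close> to \<open>T\<close> in \<open>G - v\<close> closes up through \<open>v\<close> to an induced cycle.\<close>

lemma induced_cycle_through:
  assumes conn: "\<And>u w. u \<in> S \<Longrightarrow> w \<in> T \<Longrightarrow> (adj_avoiding G v)\<^sup>*\<^sup>* u w"
    and nbs: "\<And>u. adj G v u \<longleftrightarrow> u \<in> S \<union> T" and ne: "S \<noteq> {}" "T \<noteq> {}" and dis: "S \<inter> T = {}"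
  obtains n p where "induced_cycle G n p" "p 0 = v" "p 1 \<in> S" "p (n - 1) \<in> T"
proof -
  \<comment> \<open>Walks with \<open>k\<close> steps from \<open>S\<close> to \<open>T\<close> that
    avoid \<open>v\<close>. Minimality of \<open>k\<close> makes them chordless paths whose inner
    vertices lie outside \<open>S\<close> and \<open>T\<close>, hence are not adjacent to
    \<open>v\<close>.\<close>
  define Q where "Q k q \<longleftrightarrow> q 0 \<in> S \<and> q k \<in> T \<and> (\<forall>i<k. adj G (q i) (q (Suc i))) \<and>
    (\<forall>i\<le>k. q i \<noteq> v)" for k and q :: "nat \<Rightarrow> 'a"
  obtain s t where st: "s \<in> S" "t \<in> T" using ne by blast
  have vnot: "v \<notin> S" "v \<notin> T" using nbs[of v] by auto
  have "\<exists>k q. q 0 = s \<and> q k = w \<and> (\<forall>i<k. adj G (q i) (q (Suc i))) \<and> (\<forall>i\<le>k. q i \<noteq> v)"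
    if "(adj_avoiding G v)\<^sup>*\<^sup>* s w" for w
    using that
  proof (induction rule: rtranclp_induct)
    case base
    show ?case using st vnot by (intro exI[of _ 0] exI[of _ "\<lambda>_. s"]) auto
  next
    case (step y z)
    then obtain k q where q: "q 0 = s" "q k = y" "\<forall>i<k. adj G (q i) (q (Suc i))"
      "\<forall>i\<le>k. q i \<noteq> v" by blast
    have "adj G y z" "z \<noteq> v" using step.hyps(2) by (auto simp: adj_avoiding_def)
    then show ?case
      using q by (intro exI[of _ "Suc k"] exI[of _ "q(Suc k := z)"])
        (auto simp: less_Suc_eq le_Suc_eq)
  qed
  from this[OF conn[OF st]] have "\<exists>k q. Q k q"
    using st unfolding Q_def by metis
  then have "\<exists>k. \<exists>q. Q k q" by blast
  define k where "k = (LEAST k. \<exists>q. Q k q)"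
  obtain q where q: "Q k q"
    using LeastI_ex[OF \<open>\<exists>k. \<exists>q. Q k q\<close>] unfolding k_def by blast
  have min: "k \<le> k'" if "Q k' q'" for k' q'
    using Least_le[of "\<lambda>k. \<exists>q. Q k q" k'] that unfolding k_def by blast
  have q0: "q 0 \<in> S" "q k \<in> T" and qa: "\<And>i. i < k \<Longrightarrow> adj G (q i) (q (Suc i))"
    and qv: "\<And>i. i \<le> k \<Longrightarrow> q i \<noteq> v"
    using q by (auto simp: Q_def)
  have k0: "k > 0" using q0 dis by (cases k) auto
  have notS: "q i \<notin> S" if "0 < i" "i \<le> k" for i
  proof
    assume "q i \<in> S"
    then have "Q (k - i) (\<lambda>l. q (l + i))"
      using that q0 qa qv by (auto simp: Q_def)
    from min[OF this] that show False by simp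
  qed
  have notT: "q i \<notin> T" if "i < k" for i
  proof
    assume "q i \<in> T"
    then have "Q i q"
      using that q0 qa qv by (auto simp: Q_def)
    from min[OF this] that show False by simp
  qed
  have inj: "q i \<noteq> q j" if "i < j" "j \<le> k" for i j
  proof
    assume eq: "q i = q j"
    \<comment> \<open>Cut out the closed part between the equal vertices \<open>q i\<close> and
      \<open>q j\<close>.\<close>
    let ?q = "\<lambda>l. if l \<le> i then q l else q (l + (j - i))"
    have "adj G (?q l) (?q (Suc l))" if "l < k - (j - i)" for l
      using that eq qa[of l] qa[of "l + (j - i)"] \<open>i < j\<close> \<open>j \<le> k\<close>
      by (cases "l = i") (auto simp: not_le less_Suc_eq)
    moreover have "?q (k - (j - i)) = q k"
      using that eq by (cases "j = k") auto
    ultimately have "Q (k - (j - i)) ?q"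
      using that q0 qv by (auto simp: Q_def)
    from min[OF this] that show False by simp
  qed
  have ind: "\<not> adj G (q i) (q j)" if "Suc i < j" "j \<le> k" for i j
  proof
    assume eq: "adj G (q i) (q j)"
    let ?d = "j - Suc i"
    \<comment> \<open>Jump along the chord from \<open>q i\<close> straight to
      \<open>q j\<close>.\<close>
    let ?q = "\<lambda>l. if l \<le> i then q l else q (l + ?d)"
    have "adj G (?q l) (?q (Suc l))" if "l < k - ?d" for l
      using that eq qa[of l] qa[of "l + ?d"] \<open>Suc i < j\<close> \<open>j \<le> k\<close>
      by (cases "l = i") (auto simp: not_le less_Suc_eq)
    then have "Q (k - ?d) ?q"
      using that q0 qv by (auto simp: Q_def)
    from min[OF this] that show False by simp
  qed
  \<comment> \<open>\<open>v\<close> takes position 0 and the \<open>k + 1\<close> vertices of the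
    path take the positions 1 to \<open>k + 1\<close>.\<close>
  define n where "n = k + 2"
  define p where "p i = (if i mod n = 0 then v else q (i mod n - 1))" for i
  have n3: "n \<ge> 3" using k0 by (simp add: n_def)
  have adjv: "adj G v (q j) \<longleftrightarrow> j = 0 \<or> j = k" if "j \<le> k" for j
    using nbs[of "q j"] notS[of j] notT[of j] q0 that by auto
  have adjq: "adj G (q i) (q j) \<longleftrightarrow> Suc i = j \<or> Suc j = i" if "i \<le> k" "j \<le> k" for i j
    using qa[of i] qa[of j] ind[of i j] ind[of j i] that adj_sym[of G "q i" "q j"]
      adj_sym[of G "q j" "q i"]
    by (cases i j rule: linorder_cases) (auto dest: Suc_lessI)
  have pred: "i mod n - 1 \<le> k" for i
    using mod_less_divisor[of n i] n3 unfolding n_def by linarith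
  have inj': "q i = q j \<longleftrightarrow> i = j" if "i \<le> k" "j \<le> k" for i j
    using inj[of i j] inj[of j i] that by (cases i j rule: linorder_cases) auto
  have "induced_cycle G n p"
    unfolding induced_cycle_def
  proof (intro conjI allI n3)
    fix i j
    show "p i = p j \<longleftrightarrow> [i = j] (mod n)"
      using qv[OF pred[of i]] qv[OF pred[of j]] inj'[OF pred[of i] pred[of j]]
      by (auto simp: p_def cong_def)
    obtain a b where ab: "i mod n = a" "j mod n = b" "a \<le> Suc k" "b \<le> Suc k"
      using pred[of i] pred[of j] by auto
    have S: "Suc i mod n = (if i mod n = Suc k then 0 else Suc (i mod n))" for i
      by (simp add: mod_Suc n_def)
    have "adj G v (q (c - 1)) \<longleftrightarrow> c = 1 \<or> c = Suc k"
      and "adj G (q (c - 1)) v \<longleftrightarrow> c = 1 \<or> c = Suc k" if "c \<noteq> 0" "c \<le> Suc k" for c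
      using that adjv[of "c - 1"] adj_commute[of G v "q (c - 1)"] by auto
    moreover have "adj G (q (a - 1)) (q (b - 1)) \<longleftrightarrow> Suc a = b \<or> Suc b = a"
      if "a \<noteq> 0" "b \<noteq> 0"
      using adjq[of "a - 1" "b - 1"] ab that by auto
    ultimately show "adj G (p i) (p j) \<longleftrightarrow> [Suc i = j] (mod n) \<or> [Suc j = i] (mod n)"
      using ab(3,4) unfolding cong_def S p_def ab(1,2) by auto
  qed
  moreover have "p 0 = v" "p 1 = q 0" "p (n - 1) = q k"
    by (auto simp: p_def n_def)
  ultimately show ?thesis
    using that q0 by simp
qed

text \<open>The coloring after the hole has moved from \<open>p 0\<close> to \<open>p i\<close>:
  each vertex that it leaves takes the color of the vertex that it enters.\<close>

primrec walk :: "('v \<Rightarrow> 'c) \<Rightarrow> (nat \<Rightarrow> 'v) \<Rightarrow> nat \<Rightarrow> 'v \<Rightarrow> 'c" where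
  "walk \<phi> p 0 = \<phi>"
| "walk \<phi> p (Suc i) = (walk \<phi> p i)(p i := walk \<phi> p i (p (Suc i)))"

lemma walk_outside: "z \<notin> range p \<Longrightarrow> walk \<phi> p i z = \<phi> z"
  by (induction i) auto

text \<open>Short of a full turn no vertex is left twice, so a vertex already passed carries the
  original color of its successor. At \<open>j = i\<close> the value is the leftover one of the
  hole.\<close>

lemma walk_cycle:
  assumes "induced_cycle G n p" "i < n" "j < n"
  shows "walk \<phi> p i (p j) = (if j < i then \<phi> (p (Suc j)) else \<phi> (p j))"
  using assms(2,3)
proof (induction i arbitrary: j)
  case (Suc i)
  then show ?case
    using induced_cycle_eq_iff[OF assms(1), of j i] by (auto simp: less_Suc_eq)
qed simp

section \<open>Recognizing a graph with multiplied edges\<close>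

text \<open>The edges of \<open>B\<close> fall into classes of \<open>t\<close> parallel edges, one
  class for each edge of \<open>G\<close>. Each class is numbered, and the numberings glue to a
  bijection because distinct edges have distinct images under the injective
  \<open>f\<close>.\<close>

lemma hyper_iso_multiply_edges:
  fixes G :: "('w, 'w set) hypergraph" and B :: "('v, 'e) hypergraph"
  assumes G: "\<And>e. e \<in> edges G \<Longrightarrow> inc G e = e \<and> e \<subseteq> verts G"
    and f: "bij_betw f (verts G) (verts B)" and fin: "finite (edges B)"
    and card: "\<And>e. e \<in> edges G \<Longrightarrow> card {e' \<in> edges B. inc B e' = f ` e} = t"
    and ex: "\<And>e'. e' \<in> edges B \<Longrightarrow> \<exists>e\<in>edges G. inc B e' = f ` e"
  shows "hyper_iso (multiply_edges t G) B"
proof -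
  define M where "M e = {e' \<in> edges B. inc B e' = f ` e}" for e
  have "\<exists>h. bij_betw h {..<t} (M e)" if "e \<in> edges G" for e
    using ex_bij_betw_nat_finite[of "M e"] fin card[OF that]
    by (auto simp: M_def atLeast0LessThan)
  then obtain h where h: "\<And>e. e \<in> edges G \<Longrightarrow> bij_betw (h e) {..<t} (M e)" by metis
  have inj: "f ` d = f ` e \<Longrightarrow> d = e" if "d \<in> edges G" "e \<in> edges G" for d e
    using inj_on_image_eq_iff[OF bij_betw_imp_inj_on[OF f]] G that by metis
  have hM: "h e k \<in> M e" if "e \<in> edges G" "k < t" for e k
    using bij_betwE[OF h[OF that(1)]] that(2) by auto
  let ?g = "\<lambda>(e, k). h e k"
  have "bij_betw ?g (edges G \<times> {..<t}) (edges B)"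
    unfolding bij_betw_def
  proof
    show "inj_on ?g (edges G \<times> {..<t})"
    proof (rule inj_onI, clarsimp)
      fix d k e l
      assume a: "d \<in> edges G" "k < t" "e \<in> edges G" "l < t" "h d k = h e l"
      then have "f ` d = f ` e" using hM[of d k] hM[of e l] by (simp add: M_def)
      then have "d = e" using inj a by blast
      moreover from this have "k = l"
        using bij_betw_imp_inj_on[OF h[OF a(1)]] a by (auto dest: inj_onD)
      ultimately show "d = e \<and> k = l" by blast
    qed
    show "?g ` (edges G \<times> {..<t}) = edges B"
    proof (intro equalityI subsetI)
      fix e' assume "e' \<in> ?g ` (edges G \<times> {..<t})"
      then show "e' \<in> edges B" using hM by (auto simp: M_def)
    next
      fix e' assume e': "e' \<in> edges B"
      then obtain e where e: "e \<in> edges G" "e' \<in> M e" using ex[OF e'] by (auto simp: M_def)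
      then obtain k where "k < t" "e' = h e k"
        using bij_betw_imp_surj_on[OF h[OF e(1)]] by auto
      then show "e' \<in> ?g ` (edges G \<times> {..<t})" using e by force
    qed
  qed
  moreover have "inc B (?g x) = f ` inc (multiply_edges t G) x" if "x \<in> edges G \<times> {..<t}" for x
    using that hM G by (auto simp: multiply_edges_def M_def)
  ultimately show ?thesis
    using f unfolding hyper_iso_def
    by (intro exI[of _ f] exI[of _ ?g]) (simp add: multiply_edges_def)
qed

lemma pair_edges_eq:
  assumes "\<And>e. e \<in> pair_edges G u v \<Longrightarrow> inc G e = {u, v}"
  shows "{e \<in> edges G. inc G e = {u, v}} = pair_edges G u v"
  using assms by (auto simp: pair_edges_def)

lemma edge_two_vertices:
  assumes "hypergraph G" "e \<in> edges G"
  obtains u v where "u \<in> inc G e" "v \<in> inc G e" "adj G u v"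
proof -
  have "card (inc G e) \<ge> 2" using assms by (simp add: hypergraph_def)
  then obtain T where "T \<subseteq> inc G e" "card T = 2"
    using obtain_subset_with_card_n by metis
  then obtain u v where "u \<in> inc G e" "v \<in> inc G e" "u \<noteq> v"
    by (auto simp: card_2_iff)
  then show ?thesis using that assms by (auto simp: adj_def)
qed

section \<open>Moving the hole\<close>

text \<open>\<open>St v \<phi>\<close> means that the hole is at \<open>v\<close> while \<open>\<phi>\<close> colors the other vertices; the value \<open>\<phi> v\<close> is
  meaningless.\<close>

locale hole_system =
  fixes B :: "('v, 'e) hypergraph" and St :: "'v \<Rightarrow> ('v \<Rightarrow> 'c) \<Rightarrow> bool" and r :: nat
  assumes hyp: "hypergraph B"
    and conn: "\<And>u w. u \<in> verts B \<Longrightarrow> w \<in> verts B \<Longrightarrow> (adj B)\<^sup>*\<^sup>* u w"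
    and conn_avoiding: "\<And>x u w. x \<in> verts B \<Longrightarrow> u \<in> verts B \<Longrightarrow> w \<in> verts B \<Longrightarrow>
      u \<noteq> x \<Longrightarrow> w \<noteq> x \<Longrightarrow> (adj_avoiding B x)\<^sup>*\<^sup>* u w"
    and mono: "\<And>v \<phi> e u w. St v \<phi> \<Longrightarrow> e \<in> edges B \<Longrightarrow> v \<in> inc B e \<Longrightarrow> u \<in> inc B e \<Longrightarrow>
      w \<in> inc B e \<Longrightarrow> u \<noteq> v \<Longrightarrow> w \<noteq> v \<Longrightarrow> \<phi> u = \<phi> w"
    and card_eq: "\<And>v \<phi> \<psi> c. St v \<phi> \<Longrightarrow> St v \<psi> \<Longrightarrow>
      card (colored_edges B v \<phi> c) = card (colored_edges B v \<psi> c)"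
    and card_le: "\<And>v \<phi> c. St v \<phi> \<Longrightarrow> card (colored_edges B v \<phi> c) \<le> r"
    and shift: "\<And>v \<phi> u. St v \<phi> \<Longrightarrow> adj B v u \<Longrightarrow> St u (\<phi>(v := \<phi> u))"
begin

text \<open>Equal sizes turn one inclusion into equality. This is how the invariance of the counts
  gives information on single edges.\<close>

lemma colored_edges_subset_eq:
  assumes "St v \<phi>" "St v \<psi>" "colored_edges B v \<phi> c \<subseteq> colored_edges B v \<psi> c"
  shows "colored_edges B v \<phi> c = colored_edges B v \<psi> c"
proof -
  have "finite (colored_edges B v \<psi> c)"
    using hyp by (simp add: colored_edges_def hypergraph_def)
  then show ?thesis
    using card_subset_eq[OF _ assms(3)] card_eq[OF assms(1,2)] by blast
qed

lemma St_walk: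
  assumes "St (p 0) \<phi>" "\<And>i. adj B (p i) (p (Suc i))"
  shows "St (p i) (walk \<phi> p i)"
  using assms by (induction i) (auto intro: shift)

text \<open>One full turn of the hole. \<open>walk_cycle\<close> describes all steps but the last;
  that one enters \<open>p n = p 0\<close> and carries the color of \<open>p 1\<close>, stored at
  \<open>p 0\<close> since the first step, over to \<open>p (n - 1)\<close>.\<close>

lemma rotate:
  assumes p: "induced_cycle B n p" and St: "St (p 0) \<phi>"
  obtains \<psi> where "St (p 0) \<psi>" "\<And>j. 0 < j \<Longrightarrow> Suc j < n \<Longrightarrow> \<psi> (p j) = \<phi> (p (Suc j))"
    "\<psi> (p (n - 1)) = \<phi> (p 1)" "\<And>z. z \<notin> range p \<Longrightarrow> \<psi> z = \<phi> z"
proof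
  have n: "n \<ge> 3" using p by (simp add: induced_cycle_def)
  obtain m where m: "n = Suc m" using n by (cases n) auto
  have pn: "p n = p 0" using induced_cycle_periodic[OF p, of 0] by simp
  let ?\<psi> = "walk \<phi> p n"
  show "St (p 0) ?\<psi>"
    using St_walk[of p \<phi> n] St induced_cycle_step[OF p] pn by simp
  show "?\<psi> (p j) = \<phi> (p (Suc j))" if "0 < j" "Suc j < n" for j
    using walk_cycle[OF p, of m j] induced_cycle_eq_iff[OF p, of m j] that m by auto
  show "?\<psi> (p (n - 1)) = \<phi> (p 1)"
    using walk_cycle[OF p, of m 0] n m pn by auto
  show "?\<psi> z = \<phi> z" if "z \<notin> range p" for z
    using walk_outside[OF that] .
qed

text \<open>The full turn around a triangle, written out; in effect \<open>x\<close> and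
  \<open>y\<close> exchange colors.\<close>

lemma swap:
  assumes "St v \<phi>" "adj B v x" "adj B x y" "adj B v y"
  shows "St v (\<phi>(v := \<phi> x, x := \<phi> y, y := \<phi> x))"
proof -
  have ne: "v \<noteq> x" "v \<noteq> y" "x \<noteq> y" using assms by auto
  have "St y (\<phi>(v := \<phi> x, x := \<phi> y))"
    using shift[OF shift[OF assms(1,2)] assms(3)] ne by simp
  from shift[OF this adj_sym[OF assms(4)]] show ?thesis
    using ne by simp
qed

section \<open>Colors along an induced cycle\<close>

text \<open>A rotation puts the color of \<open>p 2\<close> on \<open>p 1\<close>. If
  \<open>p (n - 1)\<close> had another color, the edges of this color at \<open>p 0\<close> could
  only be gained, so by counting they stay the same. This forces the color of \<open>p 2\<close>
  first on \<open>p 1\<close> and then, since the rotation moves the color of \<open>p 1\<close> to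
  \<open>p (n - 1)\<close>, on \<open>p (n - 1)\<close> too.\<close>

lemma cycle_last:
  assumes p: "induced_cycle B n p" and St: "St (p 0) \<phi>"
  shows "\<phi> (p (n - 1)) = \<phi> (p 2)"
proof (rule ccontr)
  assume ne: "\<phi> (p (n - 1)) \<noteq> \<phi> (p 2)"
  have n: "n \<ge> 3" using p by (simp add: induced_cycle_def)
  then have n4: "n \<ge> 4" using ne by (cases "n = 3") auto
  obtain \<psi> where \<psi>: "St (p 0) \<psi>" "\<And>j. 0 < j \<Longrightarrow> Suc j < n \<Longrightarrow> \<psi> (p j) = \<phi> (p (Suc j))"
    "\<psi> (p (n - 1)) = \<phi> (p 1)" "\<And>z. z \<notin> range p \<Longrightarrow> \<psi> z = \<phi> z"
    using rotate[OF p St] by metis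
  have \<psi>1: "\<psi> (p 1) = \<phi> (p 2)" using \<psi>(2)[of 1] n by (simp add: numeral_2_eq_2)
  have nb: "u = p 1 \<or> u = p (n - 1) \<or> u \<notin> range p" if "adj B (p 0) u" for u
    using induced_cycle_adj_start[OF p] that unfolding induced_cycle_range[OF p] by auto
  have "colored_edges B (p 0) \<phi> (\<phi> (p 2)) \<subseteq> colored_edges B (p 0) \<psi> (\<phi> (p 2))"
  proof
    fix e assume "e \<in> colored_edges B (p 0) \<phi> (\<phi> (p 2))"
    then obtain u where u: "e \<in> edges B" "p 0 \<in> inc B e" "u \<in> inc B e" "u \<noteq> p 0" "\<phi> u = \<phi> (p 2)"
      by (auto simp: colored_edges_def)
    then have "adj B (p 0) u" by (auto simp: adj_def)
    from nb[OF this] have "\<psi> u = \<phi> (p 2)"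
      using u(5) ne \<psi>(4) \<psi>1 by auto
    then show "e \<in> colored_edges B (p 0) \<psi> (\<phi> (p 2))"
      using u by (auto simp: colored_edges_def)
  qed
  from colored_edges_subset_eq[OF St \<psi>(1) this]
  have eq: "e \<in> colored_edges B (p 0) \<phi> (\<phi> (p 2)) \<longleftrightarrow> e \<in> colored_edges B (p 0) \<psi> (\<phi> (p 2))"
    for e by blast
  \<comment> \<open>An edge joining \<open>p 0\<close> to \<open>u\<close> has the color of
    \<open>p 2\<close> after the rotation, hence also before it, and then \<open>mono\<close> gives
    this color to \<open>u\<close>.\<close>
  have bad: "\<phi> u = \<phi> (p 2)" if u: "adj B (p 0) u" "\<psi> u = \<phi> (p 2)" for u
  proof -
    obtain e where e: "e \<in> edges B" "p 0 \<in> inc B e" "u \<in> inc B e" "u \<noteq> p 0"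
      using u(1) unfolding adj_def by blast
    then have "e \<in> colored_edges B (p 0) \<psi> (\<phi> (p 2))"
      using u(2) by (auto simp: colored_edges_def)
    then obtain w where "w \<in> inc B e" "w \<noteq> p 0" "\<phi> w = \<phi> (p 2)"
      unfolding eq[symmetric] by (auto simp: colored_edges_def)
    then show ?thesis using mono[OF St e(1,2) e(3), of w] e(4) by simp
  qed
  have "\<phi> (p 1) = \<phi> (p 2)"
    using bad[OF _ \<psi>1] induced_cycle_step[OF p, of 0] by simp
  moreover have "adj B (p 0) (p (n - 1))"
    using induced_cycle_step[OF p, of "n - 1"] induced_cycle_periodic[OF p, of 0] n
    by (simp add: adj_sym)
  ultimately show False
    using bad[of "p (n - 1)"] \<psi>(3) ne by simp
qed

text \<open>Move the hole to \<open>p i\<close> and apply \<open>cycle_last\<close> to the cycle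
  started there: its last vertex \<open>p (i - 1)\<close> now carries the old color of
  \<open>p i\<close>, while \<open>p (i + 2)\<close> has not been touched.\<close>

lemma cycle_alternating:
  assumes p: "induced_cycle B n p" and St: "St (p 0) \<phi>" and i: "0 < i" "i + 2 < n"
  shows "\<phi> (p (i + 2)) = \<phi> (p i)"
proof -
  have St': "St (p i) (walk \<phi> p i)"
    using St_walk[of p \<phi> i] St induced_cycle_step[OF p] by simp
  have eq: "p (n - 1 + i) = p (i - 1)"
    using induced_cycle_periodic[OF p, of "i - 1"] i by (simp add: algebra_simps)
  have "walk \<phi> p i (p (n - 1 + i)) = walk \<phi> p i (p (2 + i))"
    using cycle_last[OF induced_cycle_shift[OF p, of i]] St' by simp
  moreover have "walk \<phi> p i (p (i - 1)) = \<phi> (p i)"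
    using walk_cycle[OF p, of i "i - 1"] i by (simp add: less_imp_diff_less)
  moreover have "walk \<phi> p i (p (i + 2)) = \<phi> (p (i + 2))"
    using walk_cycle[OF p, of i "i + 2"] i by simp
  ultimately show ?thesis
    by (metis eq add.commute)
qed

text \<open>For even \<open>n\<close> the position \<open>n - 1\<close> is odd, so alternation would
  give it the color of \<open>p 1\<close>, whereas \<open>cycle_last\<close> gives it that of
  \<open>p 2\<close>.\<close>

lemma cycle_odd:
  assumes p: "induced_cycle B n p" and St: "St (p 0) \<phi>" and ne: "\<phi> (p 1) \<noteq> \<phi> (p 2)"
  shows "odd n"
proof
  assume "even n"
  have "2 * k + 1 < n \<Longrightarrow> \<phi> (p (2 * k + 1)) = \<phi> (p 1)" for k
    using cycle_alternating[OF p St, of "2 * k + 1" for k] by (induction k) auto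
  moreover obtain k where "n = 2 * k + 2"
  proof -
    have "n \<ge> 3" using p by (simp add: induced_cycle_def)
    then show ?thesis using \<open>even n\<close> that[of "n div 2 - 1"] by (auto elim!: evenE)
  qed
  ultimately have "\<phi> (p (n - 1)) = \<phi> (p 1)" by simp
  then show False using cycle_last[OF p St] ne by simp
qed

text \<open>Lets later arguments start at any vertex of the cycle. A step leaves the color of the
  entered vertex behind the hole, and \<open>cycle_last\<close> forces that color two places ahead,
  so the next two colors differ again.\<close>

lemma cycle_shift_hole:
  assumes p: "induced_cycle B n p" and St: "St (p 0) \<phi>" and ne: "\<phi> (p 1) \<noteq> \<phi> (p 2)"
  obtains \<psi> where "St (p i) \<psi>" "\<psi> (p (i + 1)) \<noteq> \<psi> (p (i + 2))"
proof -
  have "\<exists>\<psi>. St (p i) \<psi> \<and> \<psi> (p (i + 1)) \<noteq> \<psi> (p (i + 2))"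
  proof (induction i)
    case 0
    then show ?case using St ne by (intro exI[of _ \<phi>]) (simp add: numeral_2_eq_2)
  next
    case (Suc i)
    then obtain \<psi> where \<psi>: "St (p i) \<psi>" "\<psi> (p (i + 1)) \<noteq> \<psi> (p (i + 2))" by blast
    let ?\<psi> = "\<psi>(p i := \<psi> (p (Suc i)))"
    have St': "St (p (Suc i)) ?\<psi>"
      by (rule shift[OF \<psi>(1) induced_cycle_step[OF p]])
    have n: "n \<ge> 3" using p by (simp add: induced_cycle_def)
    have "p (n - 1 + Suc i) = p i"
      using induced_cycle_periodic[OF p, of i] n by (simp add: add.commute)
    then have "?\<psi> (p (i + 3)) = ?\<psi> (p i)"
      using cycle_last[OF induced_cycle_shift[OF p, of "Suc i"], of ?\<psi>] St'
      by (simp add: add.commute numeral_3_eq_3 numeral_2_eq_2)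
    moreover have "p (i + 2) \<noteq> p i"
      using p n unfolding induced_cycle_def
      by (auto simp: cong_add_lcancel_0_nat cong_0_iff simp del: add_2_eq_Suc' dest: dvd_imp_le)
    ultimately have "?\<psi> (p (i + 2)) \<noteq> ?\<psi> (p (i + 3))"
      using \<psi>(2) by simp
    then show ?case using St' by (intro exI[of _ ?\<psi>]) (simp add: eval_nat_numeral del: fun_upd_apply)
  qed
  then show ?thesis using that by blast
qed

text \<open>A further vertex of an edge through \<open>p 0\<close> and \<open>p 1\<close> would
  share the color of \<open>p 1\<close> before and after a rotation. Vertices off the cycle keep
  their color while \<open>p 1\<close> changes, and \<open>p (n - 1)\<close> differs from
  \<open>p 1\<close> from the start. The multiplicities agree because the edges of the color of
  \<open>p 2\<close> at \<open>p 0\<close> lead to \<open>p (n - 1)\<close> before the rotation and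
  to \<open>p 1\<close> after it.\<close>

lemma cycle_pair_edges:
  assumes p: "induced_cycle B n p" and St: "St (p 0) \<phi>" and ne: "\<phi> (p 1) \<noteq> \<phi> (p 2)"
  shows "e \<in> pair_edges B (p 0) (p 1) \<Longrightarrow> inc B e = {p 0, p 1}"
    and "card (pair_edges B (p 0) (p 1)) = card (pair_edges B (p 0) (p (n - 1)))"
proof -
  have n: "n \<ge> 3" using p by (simp add: induced_cycle_def)
  obtain \<psi> where \<psi>: "St (p 0) \<psi>" "\<And>j. 0 < j \<Longrightarrow> Suc j < n \<Longrightarrow> \<psi> (p j) = \<phi> (p (Suc j))"
    "\<psi> (p (n - 1)) = \<phi> (p 1)" "\<And>z. z \<notin> range p \<Longrightarrow> \<psi> z = \<phi> z"
    using rotate[OF p St] by metis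
  have \<psi>1: "\<psi> (p 1) = \<phi> (p 2)" using \<psi>(2)[of 1] n by (simp add: numeral_2_eq_2)
  have last: "\<phi> (p (n - 1)) = \<phi> (p 2)" by (rule cycle_last[OF p St])
  have nb: "u = p 1 \<or> u = p (n - 1) \<or> u \<notin> range p" if "adj B (p 0) u" for u
    using induced_cycle_adj_start[OF p] that unfolding induced_cycle_range[OF p] by auto
  have d: "p 0 \<noteq> p 1" "p 0 \<noteq> p (n - 1)"
    using induced_cycle_eq_iff[OF p, of 0] n by auto
  show "inc B e = {p 0, p 1}" if e: "e \<in> pair_edges B (p 0) (p 1)" for e
  proof -
    have "z \<in> {p 0, p 1}" if z: "z \<in> inc B e" for z
    proof (rule ccontr)
      assume z': "z \<notin> {p 0, p 1}"
      have "adj B (p 0) z" using e z z' by (auto simp: adj_def pair_edges_def)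
      moreover have "\<phi> z = \<phi> (p 1)" "\<psi> z = \<psi> (p 1)"
        using mono[OF St, of e z "p 1"] mono[OF \<psi>(1), of e z "p 1"] e z z' d
        by (auto simp: pair_edges_def)
      ultimately show False
        using nb[of z] z' last \<psi>(4)[of z] \<psi>1 ne by auto
    qed
    then show ?thesis using e by (auto simp: pair_edges_def)
  qed
  \<comment> \<open>The edges of this color that meet neither cycle neighbor of \<open>p 0\<close>;
    a rotation does not affect them.\<close>
  define D where "D = {e \<in> colored_edges B (p 0) \<phi> (\<phi> (p 2)). p 1 \<notin> inc B e \<and> p (n - 1) \<notin> inc B e}"
  have fin: "finite (edges B)" using hyp by (simp add: hypergraph_def)
  have 1: "colored_edges B (p 0) \<phi> (\<phi> (p 2)) = pair_edges B (p 0) (p (n - 1)) \<union> D"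
  proof (intro set_eqI iffI)
    fix e assume "e \<in> colored_edges B (p 0) \<phi> (\<phi> (p 2))"
    moreover from this obtain u where u: "e \<in> edges B" "p 0 \<in> inc B e" "u \<in> inc B e" "u \<noteq> p 0"
      "\<phi> u = \<phi> (p 2)"
      by (auto simp: colored_edges_def)
    moreover have "p 1 \<notin> inc B e"
      using mono[OF St u(1,2,3), of "p 1"] u ne d by auto
    ultimately show "e \<in> pair_edges B (p 0) (p (n - 1)) \<union> D"
      by (auto simp: D_def pair_edges_def)
  next
    fix e assume "e \<in> pair_edges B (p 0) (p (n - 1)) \<union> D"
    then show "e \<in> colored_edges B (p 0) \<phi> (\<phi> (p 2))"
      using d last by (auto simp: D_def colored_edges_def pair_edges_def)
  qed
  have 2: "colored_edges B (p 0) \<psi> (\<phi> (p 2)) = pair_edges B (p 0) (p 1) \<union> D"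
  proof (intro set_eqI iffI)
    fix e assume "e \<in> colored_edges B (p 0) \<psi> (\<phi> (p 2))"
    then obtain u where u: "e \<in> edges B" "p 0 \<in> inc B e" "u \<in> inc B e" "u \<noteq> p 0" "\<psi> u = \<phi> (p 2)"
      by (auto simp: colored_edges_def)
    then have "adj B (p 0) u" by (auto simp: adj_def)
    moreover have "p (n - 1) \<notin> inc B e"
      using mono[OF \<psi>(1) u(1,2,3), of "p (n - 1)"] u ne \<psi>(3) d by auto
    ultimately show "e \<in> pair_edges B (p 0) (p 1) \<union> D"
      using nb[of u] u \<psi>(4)[of u] by (auto simp: D_def colored_edges_def pair_edges_def)
  next
    fix e assume e: "e \<in> pair_edges B (p 0) (p 1) \<union> D"
    show "e \<in> colored_edges B (p 0) \<psi> (\<phi> (p 2))"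
    proof (cases "e \<in> D")
      case True
      then obtain u where u: "e \<in> edges B" "p 0 \<in> inc B e" "u \<in> inc B e" "u \<noteq> p 0" "\<phi> u = \<phi> (p 2)"
        "p 1 \<notin> inc B e" "p (n - 1) \<notin> inc B e"
        by (auto simp: colored_edges_def D_def)
      then have "adj B (p 0) u" by (auto simp: adj_def)
      then show ?thesis using u nb[of u] \<psi>(4)[of u] by (auto simp: colored_edges_def)
    next
      case False
      then show ?thesis using e d \<psi>1 by (auto simp: colored_edges_def pair_edges_def)
    qed
  qed
  have "card (pair_edges B (p 0) (p (n - 1)) \<union> D) = card (pair_edges B (p 0) (p 1) \<union> D)"
    using card_eq[OF St \<psi>(1), of "\<phi> (p 2)"] by (simp only: 1 2)
  moreover have "finite D" "finite (pair_edges B u v)" for u v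
    using fin by (auto simp: D_def pair_edges_def colored_edges_def)
  moreover have "pair_edges B (p 0) (p (n - 1)) \<inter> D = {}" "pair_edges B (p 0) (p 1) \<inter> D = {}"
    by (auto simp: D_def pair_edges_def)
  ultimately show "card (pair_edges B (p 0) (p 1)) = card (pair_edges B (p 0) (p (n - 1)))"
    by (simp add: card_Un_disjoint)
qed

section \<open>Ears and long cycles\<close>

text \<open>The hole leaves \<open>S\<close> from \<open>x\<close> to \<open>z\<close> and follows a
  walk avoiding \<open>x\<close> up to its first return \<open>y\<close> to \<open>S\<close>. As
  \<open>y\<close> does not depend on the coloring, one ear can be used with several
  colorings.\<close>

lemma ear:
  assumes S: "x \<in> S" "S \<subseteq> verts B" "y0 \<in> S" "y0 \<noteq> x" and z: "adj B x z" "z \<notin> S"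
  obtains y where "y \<in> S" "y \<noteq> x"
    "\<And>\<phi>. St x \<phi> \<Longrightarrow> \<exists>\<psi>. St y \<psi> \<and> \<psi> x = \<phi> z \<and> (\<forall>w\<in>S - {x, y}. \<psi> w = \<phi> w)"
proof -
  let ?goal = "\<exists>y\<in>S. y \<noteq> x \<and>
    (\<forall>\<phi>. St x \<phi> \<longrightarrow> (\<exists>\<psi>. St y \<psi> \<and> \<psi> x = \<phi> z \<and> (\<forall>w\<in>S - {x, y}. \<psi> w = \<phi> w)))"
  have "(adj_avoiding B x)\<^sup>*\<^sup>* z y0"
    using conn_avoiding[of x z y0] S z adj_verts[OF hyp z(1)] by auto
  \<comment> \<open>Along the walk, either \<open>S\<close> has been met again, or the current
    vertex is outside \<open>S\<close> and the colors on \<open>S - {x}\<close> are intact. At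
    \<open>y0\<close> only the former is possible.\<close>
  then have "?goal \<or> y0 \<notin> S \<and>
    (\<forall>\<phi>. St x \<phi> \<longrightarrow> (\<exists>\<psi>. St y0 \<psi> \<and> \<psi> x = \<phi> z \<and> (\<forall>w\<in>S - {x}. \<psi> w = \<phi> w)))"
  proof (induction rule: rtranclp_induct)
    case base
    have "\<exists>\<psi>. St z \<psi> \<and> \<psi> x = \<phi> z \<and> (\<forall>w\<in>S - {x}. \<psi> w = \<phi> w)" if "St x \<phi>" for \<phi>
      using shift[OF that z(1)] by (intro exI[of _ "\<phi>(x := \<phi> z)"]) auto
    then show ?case using z by blast
  next
    case (step q q')
    show ?case
    proof (cases ?goal)
      case False
      then have q: "q \<notin> S" and
        ex: "\<And>\<phi>. St x \<phi> \<Longrightarrow> \<exists>\<psi>. St q \<psi> \<and> \<psi> x = \<phi> z \<and> (\<forall>w\<in>S - {x}. \<psi> w = \<phi> w)"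
        using step.IH by blast+
      have adj: "adj B q q'" "q \<noteq> x" "q' \<noteq> x"
        using step.hyps(2) by (auto simp: adj_avoiding_def)
      have ex': "\<exists>\<psi>. St q' \<psi> \<and> \<psi> x = \<phi> z \<and> (\<forall>w\<in>S - {x}. \<psi> w = \<phi> w)" if St: "St x \<phi>" for \<phi>
      proof -
        obtain \<psi> where \<psi>: "St q \<psi>" "\<psi> x = \<phi> z" "\<forall>w\<in>S - {x}. \<psi> w = \<phi> w"
          using ex[OF St] by blast
        then show ?thesis
          using shift[OF \<psi>(1) adj(1)] q adj by (intro exI[of _ "\<psi>(q := \<psi> q')"]) auto
      qed
      show ?thesis
      proof (cases "q' \<in> S")
        case True
        have "\<exists>\<psi>. St q' \<psi> \<and> \<psi> x = \<phi> z \<and> (\<forall>w\<in>S - {x, q'}. \<psi> w = \<phi> w)" if "St x \<phi>" for \<phi>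
          using ex'[OF that] by blast
        then show ?thesis using True adj(3) by blast
      next
        case False
        then show ?thesis using ex' by blast
      qed
    qed blast
  qed
  then show ?thesis using that S(3) by blast
qed

text \<open>A vertex off the cycle gives an ear from some cycle vertex, renamed \<open>q 0\<close>,
  back to some \<open>q j\<close>. Seen from \<open>q j\<close> the cycle must alternate again, now
  with the color of \<open>z\<close> at \<open>q 0\<close>, and each position of \<open>j\<close>
  leads to a contradiction.\<close>

lemma long_cycle_spans:
  assumes p: "induced_cycle B n p" and St0: "St (p 0) \<phi>0" and ne0: "\<phi>0 (p 1) \<noteq> \<phi>0 (p 2)"
    and n4: "n \<ge> 4"
  shows "verts B = range p"
proof (rule ccontr)
  assume contr: "verts B \<noteq> range p"
  have n5: "n \<ge> 5" using cycle_odd[OF p St0 ne0] n4 by (cases "n = 4") auto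
  have sub: "range p \<subseteq> verts B"
    using adj_verts[OF hyp induced_cycle_step[OF p]] by blast
  then obtain z0 where z0: "z0 \<in> verts B" "z0 \<notin> range p" using contr by blast
  have "(adj B)\<^sup>*\<^sup>* (p 0) z0" using conn[of "p 0" z0] z0 sub by auto
  then have "z0 \<in> range p \<or> (\<exists>i z. z \<notin> range p \<and> adj B (p i) z)"
  proof (induction rule: rtranclp_induct)
    case (step y z)
    then show ?case by (cases "z \<in> range p") auto
  qed simp
  then obtain k z where z: "z \<notin> range p" "adj B (p k) z" using z0 by blast
  define q where "q = (\<lambda>i. p (i + k))"
  have q: "induced_cycle B n q" unfolding q_def by (rule induced_cycle_shift[OF p])
  obtain \<phi> where \<phi>: "St (q 0) \<phi>" "\<phi> (q 1) \<noteq> \<phi> (q 2)"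
    using cycle_shift_hole[OF p St0 ne0, of k] by (auto simp: q_def add.commute)
  have qz: "adj B (q 0) z" "z \<notin> range q" "range q \<subseteq> verts B"
    using z sub by (auto simp: q_def)
  have q01: "q 1 \<noteq> q 0" using induced_cycle_eq_iff[OF q, of 1 0] n5 by simp
  obtain y where y: "y \<in> range q" "y \<noteq> q 0" and
    ear: "\<And>\<phi>. St (q 0) \<phi> \<Longrightarrow> \<exists>\<psi>. St y \<psi> \<and> \<psi> (q 0) = \<phi> z \<and> (\<forall>w\<in>range q - {q 0, y}. \<psi> w = \<phi> w)"
    using ear[of "q 0" "range q" "q 1" z] qz q01 by auto
  obtain j where j: "j < n" "j \<noteq> 0" "y = q j"
    using y unfolding induced_cycle_range[OF q] by (metis imageE lessThan_iff)
  have qn: "q (i + n) = q i" for i by (rule induced_cycle_periodic[OF q])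
  note s = induced_cycle_shift[OF q, of j]
  have keep: "\<psi> (q i) = \<phi> (q i)" if "\<forall>w\<in>range q - {q 0, y}. \<psi> w = \<phi> w" "i < n" "i \<noteq> 0" "i \<noteq> j"
    for \<psi> \<phi> :: "'v \<Rightarrow> 'c" and i
    using that induced_cycle_eq_iff[OF q, of i] j n5 by auto
  \<comment> \<open>The rotation interchanges the colors of \<open>q 1\<close> and
    \<open>q 2\<close> but leaves \<open>z\<close> alone. For \<open>j = 1\<close> and
    \<open>j = n - 1\<close> the color of \<open>z\<close> must equal that of a fixed cycle vertex
    in every coloring, which \<open>\<phi>\<close> and \<open>\<rho>\<close> cannot both
    satisfy.\<close>
  obtain \<rho> where \<rho>: "St (q 0) \<rho>" "\<rho> (q 1) = \<phi> (q 2)" "\<rho> (q 2) = \<phi> (q 3)" "\<rho> z = \<phi> z"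
  proof -
    obtain \<rho> where "St (q 0) \<rho>" "\<And>j. 0 < j \<Longrightarrow> Suc j < n \<Longrightarrow> \<rho> (q j) = \<phi> (q (Suc j))"
      "\<And>z. z \<notin> range q \<Longrightarrow> \<rho> z = \<phi> z"
      using rotate[OF q \<phi>(1)] by metis
    then show ?thesis using that[of \<rho>] n5 qz by (simp add: eval_nat_numeral)
  qed
  have alt: "\<phi> (q 3) = \<phi> (q 1)" if "St (q 0) \<phi>" for \<phi>
    using cycle_alternating[OF q that, of 1] n5 by (simp add: eval_nat_numeral)
  consider "j = 1" | "j = n - 1" | "2 \<le> j" "j + 2 \<le> n" using j by linarith
  then show False
  proof cases
    case 1
    have "\<phi> z = \<phi> (q 1)" if St: "St (q 0) \<phi>" for \<phi>
    proof -
      obtain \<psi> where \<psi>: "St y \<psi>" "\<psi> (q 0) = \<phi> z" "\<forall>w\<in>range q - {q 0, y}. \<psi> w = \<phi> w"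
        using ear[OF St] by blast
      have "\<psi> (q (n - 1 + j)) = \<psi> (q (2 + j))"
        using cycle_last[OF s, of \<psi>] \<psi>(1) j by simp
      then have "\<psi> (q 0) = \<psi> (q 3)" using 1 n5 qn[of 0] by simp
      then show ?thesis using \<psi> keep[OF \<psi>(3), of 3] n5 1 alt[OF St] by simp
    qed
    from this[OF \<phi>(1)] this[OF \<rho>(1)] show False using \<rho> \<phi> by simp
  next
    case 2
    have "\<phi> z = \<phi> (q 2)" if St: "St (q 0) \<phi>" for \<phi>
    proof -
      obtain \<psi> where \<psi>: "St y \<psi>" "\<psi> (q 0) = \<phi> z" "\<forall>w\<in>range q - {q 0, y}. \<psi> w = \<phi> w"
        using ear[OF St] by blast
      have "\<psi> (q (1 + 2 + j)) = \<psi> (q (1 + j))"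
        using cycle_alternating[OF s, of \<psi> 1] \<psi>(1) j n5 by simp
      moreover have "1 + 2 + j = 2 + n" "1 + j = 0 + n" using 2 n5 by simp_all
      ultimately have "\<psi> (q 2) = \<psi> (q 0)" by (metis qn)
      then show ?thesis using \<psi> keep[OF \<psi>(3), of 2] n5 2 by simp
    qed
    from this[OF \<phi>(1)] this[OF \<rho>(1)] show False using \<rho> \<phi> alt[OF \<phi>(1)] by simp
  next
    \<comment> \<open>Here \<open>q 1\<close> and \<open>q (n - 1)\<close> keep their colors. They
      lie two apart around \<open>q 0\<close>, so alternation seen from \<open>q j\<close> equates
      them.\<close>
    case 3
    obtain \<psi> where \<psi>: "St y \<psi>" "\<psi> (q 0) = \<phi> z" "\<forall>w\<in>range q - {q 0, y}. \<psi> w = \<phi> w"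
      using ear[OF \<phi>(1)] by blast
    have "\<psi> (q (n - 1 - j + 2 + j)) = \<psi> (q (n - 1 - j + j))"
      using cycle_alternating[OF s, of \<psi> "n - 1 - j"] \<psi>(1) j 3 by simp
    moreover have "n - 1 - j + 2 + j = 1 + n" "n - 1 - j + j = n - 1" using 3 by simp_all
    ultimately have "\<psi> (q 1) = \<psi> (q (n - 1))" by (metis qn)
    then have "\<phi> (q 1) = \<phi> (q (n - 1))"
      using keep[OF \<psi>(3), of 1] keep[OF \<psi>(3), of "n - 1"] 3 by simp
    then show False using cycle_last[OF q \<phi>(1)] \<phi>(2) by simp
  qed
qed

text \<open>The cycle is induced and spans \<open>B\<close>, so every edge contains two consecutive
  vertices. \<open>cycle_pair_edges\<close>, applied at each position, shows that it contains
  nothing else and that the multiplicity is the same all around.\<close>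

lemma long_cycle_brick:
  assumes p: "induced_cycle B n p" and St: "St (p 0) \<phi>" and ne: "\<phi> (p 1) \<noteq> \<phi> (p 2)"
    and n4: "n \<ge> 4"
  shows "brick B"
proof -
  have V: "verts B = range p" by (rule long_cycle_spans[OF assms])
  define t where "t = card (pair_edges B (p 0) (p 1))"
  have fin: "finite (edges B)" using hyp by (simp add: hypergraph_def)
  have per: "p (i + n) = p i" for i by (rule induced_cycle_periodic[OF p])
  have inc: "inc B e = {p i, p (Suc i)}" if "e \<in> pair_edges B (p i) (p (Suc i))" for e i
  proof -
    obtain \<psi> where "St (p i) \<psi>" "\<psi> (p (i + 1)) \<noteq> \<psi> (p (i + 2))"
      using cycle_shift_hole[OF p St ne] .
    then show ?thesis
      using cycle_pair_edges(1)[OF induced_cycle_shift[OF p, of i], of \<psi> e] that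
      by (simp add: add.commute)
  qed
  have card: "card (pair_edges B (p i) (p (Suc i))) = t" for i
  proof (induction i)
    case (Suc i)
    obtain \<psi> where "St (p (Suc i)) \<psi>" "\<psi> (p (Suc i + 1)) \<noteq> \<psi> (p (Suc i + 2))"
      using cycle_shift_hole[OF p St ne] .
    moreover have "n - 1 + Suc i = i + n" using n4 by simp
    ultimately show ?case
      using cycle_pair_edges(2)[OF induced_cycle_shift[OF p, of "Suc i"], of \<psi>] Suc per[of i]
        pair_edges_commute[of B "p i"]
      by (simp add: add.commute)
  qed (simp add: t_def)
  have t: "t \<ge> 1"
  proof -
    obtain e where "e \<in> pair_edges B (p 0) (p 1)"
      using induced_cycle_step[OF p, of 0] by (auto simp: adj_def pair_edges_def)
    moreover have "finite (pair_edges B (p 0) (p 1))" using fin by (simp add: pair_edges_def)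
    ultimately show ?thesis by (auto simp: t_def Suc_le_eq card_gt_0_iff)
  qed
  have mod: "p (i mod n) = p i" for i using p by (simp add: induced_cycle_def)
  have img: "p ` {k, (k + 1) mod n} = {p k, p (Suc k)}" for k using mod[of "k + 1"] by simp
  have "hyper_iso (multiply_edges t (cycle_graph n)) B"
  proof (rule hyper_iso_multiply_edges[where f = p])
    show "bij_betw p (verts (cycle_graph n)) (verts B)"
      using induced_cycle_eq_iff[OF p] unfolding V induced_cycle_range[OF p]
      by (auto simp: cycle_graph_def bij_betw_def inj_on_def)
    show "inc (cycle_graph n) e = e \<and> e \<subseteq> verts (cycle_graph n)" if "e \<in> edges (cycle_graph n)" for e
      using that n4 by (auto simp: cycle_graph_def)
    show "card {e' \<in> edges B. inc B e' = p ` e} = t" if "e \<in> edges (cycle_graph n)" for e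
      using that img card pair_edges_eq[OF inc] by (auto simp: cycle_graph_def)
    show "\<exists>e\<in>edges (cycle_graph n). inc B e' = p ` e" if e': "e' \<in> edges B" for e'
    proof -
      obtain u w where uw: "u \<in> inc B e'" "w \<in> inc B e'" "adj B u w"
        using edge_two_vertices[OF hyp e'] .
      then obtain i j where ij: "u = p i" "w = p j"
        using adj_verts[OF hyp uw(3)] V by auto
      then have "[Suc i = j] (mod n) \<or> [Suc j = i] (mod n)"
        using p uw(3) unfolding induced_cycle_def by blast
      then have "p (Suc i) = p j \<or> p (Suc j) = p i"
        using p unfolding induced_cycle_def by blast
      then have "e' \<in> pair_edges B (p i) (p (Suc i)) \<or> e' \<in> pair_edges B (p j) (p (Suc j))"
        using uw(1,2) e' ij by (auto simp: pair_edges_def)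
      then obtain k where k: "e' \<in> pair_edges B (p k) (p (Suc k))" by blast
      have "p (Suc (k mod n)) = p (Suc k)"
        using mod[of "Suc (k mod n)"] mod[of "Suc k"] by (simp add: mod_Suc_eq)
      then have "inc B e' = p ` {k mod n, (k mod n + 1) mod n}"
        using inc[OF k] img[of "k mod n"] mod[of k] by simp
      moreover have "k mod n < n" using n4 by simp
      ultimately show ?thesis
        by (auto simp: cycle_graph_def simp del: image_insert)
    qed
  qed (rule fin)
  then show ?thesis
    using t n4 cycle_odd[OF p St ne] unfolding brick_def
    by (intro disjI1 exI[of _ t] exI[of _ n]) simp
qed

section \<open>Triangles and complete blocks\<close>

text \<open>The hole reaches \<open>y\<close> either directly or after \<open>x\<close> and
  \<open>w\<close> have exchanged colors. If \<open>y\<close> and \<open>w\<close> were not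
  adjacent, the second way could only lose edges of color \<open>\<phi> x\<close> at
  \<open>y\<close>, and it does lose those through \<open>x\<close>, against the invariance of the
  count.\<close>

lemma diamond_aux:
  assumes St: "St v \<phi>" and adj: "adj B v x" "adj B x y" "adj B v y" "adj B v w" "adj B x w"
    and ne: "\<phi> x \<noteq> \<phi> y" "\<phi> w \<noteq> \<phi> x" "w \<noteq> y"
  shows "adj B y w"
proof (rule ccontr)
  assume no: "\<not> adj B y w"
  have d: "v \<noteq> x" "v \<noteq> y" "x \<noteq> y" "v \<noteq> w" "x \<noteq> w" using adj by auto
  let ?\<psi> = "\<phi>(v := \<phi> y, x := \<phi> w, w := \<phi> x)"
  have 1: "St y (\<phi>(v := \<phi> y))" by (rule shift[OF St adj(3)])
  have 2: "St y ?\<psi>"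
    using shift[OF swap[OF St adj(1,5,4)] adj(3)] d ne(3) by (simp add: fun_upd_twist)
  have "colored_edges B y ?\<psi> (\<phi> x) \<subseteq> colored_edges B y (\<phi>(v := \<phi> y)) (\<phi> x)"
  proof
    fix e assume "e \<in> colored_edges B y ?\<psi> (\<phi> x)"
    then obtain u where u: "e \<in> edges B" "y \<in> inc B e" "u \<in> inc B e" "u \<noteq> y" "?\<psi> u = \<phi> x"
      by (auto simp: colored_edges_def)
    then have "adj B y u" by (auto simp: adj_def)
    then have "u \<noteq> w" using no by auto
    then have "(\<phi>(v := \<phi> y)) u = \<phi> x" using u(5) ne by (auto split: if_splits)
    then show "e \<in> colored_edges B y (\<phi>(v := \<phi> y)) (\<phi> x)"
      using u(1-4) unfolding colored_edges_def by blast
  qed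
  from colored_edges_subset_eq[OF 2 1 this]
  have eq: "colored_edges B y ?\<psi> (\<phi> x) = colored_edges B y (\<phi>(v := \<phi> y)) (\<phi> x)" .
  obtain e where e: "e \<in> edges B" "x \<in> inc B e" "y \<in> inc B e"
    using adj(2) by (auto simp: adj_def)
  then have "e \<in> colored_edges B y (\<phi>(v := \<phi> y)) (\<phi> x)"
    using d by (auto simp: colored_edges_def)
  then obtain u where u: "u \<in> inc B e" "u \<noteq> y" "?\<psi> u = \<phi> x"
    unfolding eq[symmetric] by (auto simp: colored_edges_def)
  have "?\<psi> u = ?\<psi> x" using mono[OF 2 e(1,3) u(1) e(2) u(2) d(3)] .
  then show False using u(3) ne d by simp
qed

text \<open>If \<open>w\<close> and \<open>x\<close> share a color, exchanging the colors of
  \<open>x\<close> and \<open>y\<close> first makes them differ.\<close>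

lemma diamond:
  assumes St: "St v \<phi>" and adj: "adj B v x" "adj B x y" "adj B v y" "adj B v w" "adj B x w"
    and ne: "\<phi> x \<noteq> \<phi> y" "w \<noteq> y"
  shows "adj B y w"
proof (cases "\<phi> w = \<phi> x")
  case True
  have "v \<noteq> x" "v \<noteq> y" "x \<noteq> y" "v \<noteq> w" "x \<noteq> w" using adj by auto
  then show ?thesis
    using diamond_aux[OF swap[OF St adj(1,2,3)] adj] ne True by simp
next
  case False
  then show ?thesis using diamond_aux[OF St adj ne(1)] ne by simp
qed

text \<open>Take a maximal clique among the neighbors of \<open>v\<close> that shows two colors in
  some state. A shortest connection to a neighbor outside it closes up to a triangle, and
  \<open>diamond\<close> makes that neighbor adjacent to the whole clique.\<close>

lemma neighborhood_clique:
  assumes short: "\<And>n p \<phi>. induced_cycle B n p \<Longrightarrow> St (p 0) \<phi> \<Longrightarrow> \<phi> (p 1) \<noteq> \<phi> (p 2) \<Longrightarrow> n < 4"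
    and St: "St v \<phi>" and ab: "adj B v a" "adj B v b" "\<phi> a \<noteq> \<phi> b"
    and xy: "adj B v x" "adj B v y" "x \<noteq> y"
  shows "adj B x y"
proof -
  define N where "N = {u. adj B v u}"
  have vB: "v \<in> verts B" using adj_verts[OF hyp ab(1)] by blast
  have NB: "N \<subseteq> verts B" using adj_verts[OF hyp] by (auto simp: N_def)
  then have finN: "finite N" using hyp finite_subset by (auto simp: hypergraph_def)
  have path: "(adj_avoiding B v)\<^sup>*\<^sup>* s t" if "s \<in> N" "t \<in> N" for s t
  proof -
    have "s \<noteq> v" "t \<noteq> v" using that by (auto simp: N_def)
    then show ?thesis using conn_avoiding[OF vB] that NB by blast
  qed
  have tri: "adj B (p 1) (p (n - 1))" if p: "induced_cycle B n p" and n: "n < 4" for n p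
  proof -
    have "n = 3" using p n by (auto simp: induced_cycle_def)
    then show ?thesis using induced_cycle_step[OF p, of 1] by (simp add: numeral_2_eq_2)
  qed
  define good where "good M \<longleftrightarrow> M \<subseteq> N \<and> (\<forall>s\<in>M. \<forall>t\<in>M. s \<noteq> t \<longrightarrow> adj B s t) \<and>
    (\<exists>\<phi>. St v \<phi> \<and> (\<exists>s\<in>M. \<exists>t\<in>M. \<phi> s \<noteq> \<phi> t))" for M
  have "\<exists>M. good M"
  proof -
    obtain n p where p: "induced_cycle B n p" "p 0 = v" "p 1 \<in> {u \<in> N. \<phi> u = \<phi> a}"
      "p (n - 1) \<in> {u \<in> N. \<phi> u \<noteq> \<phi> a}"
    proof (rule induced_cycle_through[of "{u \<in> N. \<phi> u = \<phi> a}" "{u \<in> N. \<phi> u \<noteq> \<phi> a}" B v])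
      show "adj B v u \<longleftrightarrow> u \<in> {u \<in> N. \<phi> u = \<phi> a} \<union> {u \<in> N. \<phi> u \<noteq> \<phi> a}" for u
        by (auto simp: N_def)
    qed (use path ab in \<open>auto simp: N_def\<close>)
    have "\<phi> (p 1) \<noteq> \<phi> (p 2)" using cycle_last[OF p(1)] St p by auto
    then have "n < 4" using short[OF p(1)] St p(2) by blast
    then have "adj B (p 1) (p (n - 1))" by (rule tri[OF p(1)])
    then have "good {p 1, p (n - 1)}"
      using p St adj_sym unfolding good_def by auto
    then show ?thesis ..
  qed
  moreover have "finite {M. good M}"
    by (rule finite_subset[of _ "Pow N"]) (auto simp: good_def finN)
  ultimately obtain M where M: "good M" and max: "\<And>M'. good M' \<Longrightarrow> M \<subseteq> M' \<Longrightarrow> M' = M"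
    using finite_has_maximal[of "{M. good M}"] by blast
  obtain \<chi> s t where \<chi>: "St v \<chi>" "s \<in> M" "t \<in> M" "\<chi> s \<noteq> \<chi> t"
    and MN: "M \<subseteq> N" and cl: "\<And>s t. s \<in> M \<Longrightarrow> t \<in> M \<Longrightarrow> s \<noteq> t \<Longrightarrow> adj B s t"
    using M unfolding good_def by blast
  \<comment> \<open>If \<open>m\<close> and \<open>w\<close> agree, exchanging \<open>m\<close> with
    a vertex of \<open>M\<close> of another color separates them, as \<open>w\<close> is not
    moved.\<close>
  have recolor: "\<exists>\<psi>. St v \<psi> \<and> \<psi> m \<noteq> \<psi> w" if m: "m \<in> M" and w: "w \<in> N" "w \<noteq> m" for m w
  proof (cases "\<chi> m = \<chi> w")
    case True
    obtain m' where m': "m' \<in> M" "\<chi> m' \<noteq> \<chi> m" using \<chi> by metis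
    then have "m \<noteq> m'" "w \<noteq> m'" using True by auto
    moreover have "w \<noteq> v" using w by (auto simp: N_def)
    moreover have "m \<noteq> v" using m MN by (auto simp: N_def)
    ultimately show ?thesis
      using swap[OF \<chi>(1), of m m'] m' m MN cl[of m m'] True w(2)
      by (intro exI[of _ "\<chi>(v := \<chi> m, m := \<chi> m', m' := \<chi> m)"]) (auto simp: N_def)
  qed (use \<chi> in blast)
  have "M = N"
  proof (rule ccontr)
    assume "M \<noteq> N"
    \<comment> \<open>By \<open>recolor\<close> the ends of this path can be given different colors,
      so \<open>short\<close> leaves only a triangle.\<close>
    obtain n p where p: "induced_cycle B n p" "p 0 = v" "p 1 \<in> M" "p (n - 1) \<in> N - M"
    proof (rule induced_cycle_through[of M "N - M" B v])
      show "adj B v u \<longleftrightarrow> u \<in> M \<union> (N - M)" for u using MN by (auto simp: N_def)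
    qed (use path MN \<open>M \<noteq> N\<close> \<chi> in auto)
    let ?w = "p (n - 1)"
    obtain \<psi> where "St v \<psi>" "\<psi> (p 1) \<noteq> \<psi> ?w"
    proof -
      have "?w \<noteq> p 1" using p(3,4) by auto
      then show ?thesis using recolor[OF p(3), of ?w] p(4) that by blast
    qed
    then have "n < 4" using short[OF p(1), of \<psi>] cycle_last[OF p(1), of \<psi>] p(2) by simp
    then have w: "adj B (p 1) ?w" by (rule tri[OF p(1)])
    have w': "adj B m ?w" if m: "m \<in> M" for m
    proof (cases "m = p 1")
      case False
      obtain \<psi> where "St v \<psi>" "\<psi> (p 1) \<noteq> \<psi> m"
        using recolor[OF p(3), of m] m MN False by auto
      then show ?thesis
        using diamond[of v \<psi> "p 1" m ?w] w cl[OF p(3) m] False p m MN by (auto simp: N_def)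
    qed (use w in simp)
    have "adj B s t" if "s \<in> insert ?w M" "t \<in> insert ?w M" "s \<noteq> t" for s t
      using that cl[of s t] w'[of s] adj_sym[OF w'[of t]] by auto
    moreover have "insert ?w M \<subseteq> N" using MN p(4) by blast
    ultimately have "good (insert ?w M)"
      unfolding good_def using \<chi> by blast
    then show False using max[of "insert ?w M"] p(4) by blast
  qed
  then show ?thesis using cl xy by (auto simp: N_def)
qed

text \<open>A hole moved to a neighbor \<open>u\<close> of \<open>v\<close> still sees two colors,
  so the neighborhood of \<open>u\<close> is a clique as well and adds nothing beyond
  \<open>v\<close> and its neighbors. By connectivity \<open>v\<close> is adjacent to all other
  vertices; triangles at \<open>v\<close> then compare the multiplicities.\<close>

lemma complete_brick:
  assumes short: "\<And>n p \<phi>. induced_cycle B n p \<Longrightarrow> St (p 0) \<phi> \<Longrightarrow> \<phi> (p 1) \<noteq> \<phi> (p 2) \<Longrightarrow> n < 4"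
    and St: "St v \<phi>" and ab: "adj B v a" "adj B v b" "\<phi> a \<noteq> \<phi> b"
  shows "brick B"
proof -
  have clique: "adj B x y" if "adj B v x" "adj B v y" "x \<noteq> y" for x y
    by (rule neighborhood_clique[OF short St ab that])
  have v: "v \<in> verts B" using adj_verts[OF hyp ab(1)] by blast
  have fin: "finite (edges B)" "finite (verts B)" using hyp by (auto simp: hypergraph_def)
  have dab: "a \<noteq> b" "v \<noteq> a" "v \<noteq> b" using ab by auto
  have closed: "w = v \<or> adj B v w" if u: "adj B v u" and w: "adj B u w" for u w
  proof (rule ccontr)
    assume no: "\<not> (w = v \<or> adj B v w)"
    \<comment> \<open>After the shift \<open>v\<close> has the color of \<open>u\<close>, and at
      least one of \<open>a\<close> and \<open>b\<close> has a different one.\<close>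
    obtain d where d: "adj B u d" "(\<phi>(v := \<phi> u)) d \<noteq> (\<phi>(v := \<phi> u)) v"
    proof (cases "\<phi> a = \<phi> u")
      case True
      then have "u \<noteq> b" using ab by auto
      then show ?thesis using that[of b] clique[OF u ab(2)] True ab dab by simp
    next
      case False
      then have "u \<noteq> a" by auto
      then show ?thesis using that[of a] clique[OF u ab(1)] False dab by simp
    qed
    have "v \<noteq> w" using no by blast
    have "adj B v w"
      by (rule neighborhood_clique[OF short shift[OF St u] d(1) adj_sym[OF u] d(2) adj_sym[OF u] w
            \<open>v \<noteq> w\<close>])
    then show False using no by blast
  qed
  have all: "adj B v w" if "w \<in> verts B" "w \<noteq> v" for w
  proof -
    have "(adj B)\<^sup>*\<^sup>* v w" using conn[OF v that(1)] .
    then have "w = v \<or> adj B v w"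
      by (induction rule: rtranclp_induct) (use closed in blast)+
    then show ?thesis using that by blast
  qed
  have tri: "inc B e = {v, x} \<and> inc B e' = {x, y} \<and>
      card (pair_edges B v x) = card (pair_edges B v y) \<and>
      card (pair_edges B x y) = card (pair_edges B v x)"
    if x: "adj B v x" and y: "adj B v y" and xy: "x \<noteq> y"
      and e: "e \<in> pair_edges B v x" and e': "e' \<in> pair_edges B x y" for x y e e'
  proof -
    have dv: "v \<noteq> x" "v \<noteq> y" using x y by auto
    \<comment> \<open>If \<open>x\<close> and \<open>y\<close> agree, exchanging \<open>x\<close>
      with a neighbor \<open>m\<close> of another color separates them.\<close>
    obtain \<psi> where \<psi>: "St v \<psi>" "\<psi> x \<noteq> \<psi> y"
    proof (cases "\<phi> x = \<phi> y")
      case True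
      obtain m where m: "adj B v m" "\<phi> m \<noteq> \<phi> x" using ab by metis
      then have "m \<noteq> x" "m \<noteq> y" using True by auto
      then show ?thesis
        using that[OF swap[OF St x clique[OF x m(1)] m(1)]] m(2) True xy dv by simp
    qed (use that St in blast)
    define p where "p = (\<lambda>i :: nat. if i mod 3 = 0 then v else if i mod 3 = 1 then x else y)"
    have p: "induced_cycle B 3 p"
      unfolding p_def by (rule triangle_induced_cycle) (use x y clique xy in auto)
    have p_simps: "p 0 = v" "p 1 = x" "p 2 = y" "p (1 + 1) = y" "p (1 + 2) = v" "p (0 + 1) = x"
      "p (2 + 1) = v" "p (3 - 1) = y" "p (3 - 1 + 1) = v"
      by (simp_all add: p_def)
    obtain \<rho> where \<rho>: "St x \<rho>" "\<rho> y \<noteq> \<rho> v"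
      using cycle_shift_hole[OF p, of \<psi> 1] \<psi> unfolding p_simps by metis
    have "inc B e = {v, x}" "card (pair_edges B v x) = card (pair_edges B v y)"
      using cycle_pair_edges[OF p, of \<psi>] \<psi> e unfolding p_simps by blast+
    moreover have "inc B e' = {x, y}" "card (pair_edges B x y) = card (pair_edges B x v)"
      using cycle_pair_edges[OF induced_cycle_shift[OF p, of 1], of \<rho>] \<rho> e'
      unfolding p_simps by blast+
    ultimately show ?thesis by (simp add: pair_edges_commute[of B x v])
  qed
  have ex: "\<exists>e. e \<in> pair_edges B x y" if "adj B x y" for x y
    using that by (auto simp: adj_def pair_edges_def)
  define t where "t = card (pair_edges B v a)"
  have t: "t \<ge> 1"
    using ex[OF ab(1)] fin by (auto simp: t_def Suc_le_eq card_gt_0_iff pair_edges_def)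
  have key: "(\<forall>e\<in>pair_edges B x y. inc B e = {x, y}) \<and> card (pair_edges B x y) = t"
    if xy: "x \<in> verts B" "y \<in> verts B" "x \<noteq> y" for x y
  proof -
    have star: "(\<forall>e\<in>pair_edges B v x. inc B e = {v, x}) \<and> card (pair_edges B v x) = t"
      if x: "x \<in> verts B" "x \<noteq> v" for x
    proof -
      have vx: "adj B v x" using all x by blast
      \<comment> \<open>A third vertex for a triangle with \<open>v\<close> and \<open>x\<close>;
        choosing \<open>a\<close> whenever possible compares directly with \<open>t\<close>.\<close>
      define c where "c = (if x = a then b else a)"
      have c: "adj B v c" "x \<noteq> c" using ab dab by (auto simp: c_def)
      obtain e' where e': "e' \<in> pair_edges B x c" using ex[OF clique[OF vx c]] by blast
      obtain e where "e \<in> pair_edges B v x" using ex[OF vx] by blast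
      from tri[OF vx c this e'] have "card (pair_edges B v x) = t"
        by (cases "x = a") (auto simp: t_def c_def)
      then show ?thesis using tri[OF vx c _ e'] by blast
    qed
    show ?thesis
    proof (cases "x = v \<or> y = v")
      case True
      then show ?thesis
        using star[of x] star[of y] that pair_edges_commute[of B x y]
        by (auto simp: insert_commute)
    next
      case False
      then have vx: "adj B v x" "adj B v y" using all xy by auto
      obtain e where "e \<in> pair_edges B v x" using ex[OF vx(1)] by blast
      moreover obtain e' where "e' \<in> pair_edges B x y" using ex[OF clique[OF vx xy(3)]] by blast
      ultimately show ?thesis
        using tri[OF vx xy(3)] star[of x] xy False by metis
    qed
  qed
  define n where "n = card (verts B)"
  have n: "n \<ge> 1" using v fin by (auto simp: n_def Suc_le_eq card_gt_0_iff)
  obtain f where f: "bij_betw f {..<n} (verts B)"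
    using ex_bij_betw_nat_finite[OF fin(2)] by (auto simp: n_def atLeast0LessThan)
  have fB: "f i \<in> verts B" if "i < n" for i using bij_betwE[OF f] that by auto
  have finj: "f i \<noteq> f j" if "i < n" "j < n" "i \<noteq> j" for i j
    using bij_betw_imp_inj_on[OF f] that by (auto dest: inj_onD)
  have "hyper_iso (multiply_edges t (complete_graph n)) B"
  proof (rule hyper_iso_multiply_edges[where f = f])
    show "bij_betw f (verts (complete_graph n)) (verts B)"
      using f by (simp add: complete_graph_def)
    show "inc (complete_graph n) e = e \<and> e \<subseteq> verts (complete_graph n)"
      if "e \<in> edges (complete_graph n)" for e
      using that by (auto simp: complete_graph_def)
    show "card {e' \<in> edges B. inc B e' = f ` e} = t" if "e \<in> edges (complete_graph n)" for e
    proof -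
      have "e \<subseteq> {..<n}" "card e = 2" using that by (auto simp: complete_graph_def)
      moreover from this(2) obtain i j where "e = {i, j}" "i \<noteq> j" unfolding card_2_iff by blast
      ultimately have e: "e = {i, j}" "i < n" "j < n" "i \<noteq> j" by auto
      then show ?thesis
        using key[OF fB fB finj, of i j] pair_edges_eq[of B "f i" "f j"] by auto
    qed
    show "\<exists>e\<in>edges (complete_graph n). inc B e' = f ` e" if e': "e' \<in> edges B" for e'
    proof -
      obtain u w where uw: "u \<in> inc B e'" "w \<in> inc B e'" "adj B u w"
        using edge_two_vertices[OF hyp e'] .
      then have uwB: "u \<in> verts B" "w \<in> verts B" "u \<noteq> w"
        using adj_verts[OF hyp uw(3)] by auto
      then obtain i j where ij: "u = f i" "w = f j" "i < n" "j < n"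
        using bij_betw_imp_surj_on[OF f] by (metis imageE lessThan_iff)
      have "inc B e' = f ` {i, j}"
        using key[OF uwB] e' uw ij by (auto simp: pair_edges_def)
      moreover have "{i, j} \<in> edges (complete_graph n)"
        using ij uwB by (auto simp: complete_graph_def card_2_iff)
      ultimately show ?thesis by blast
    qed
  qed (rule fin)
  then show ?thesis using t n by (auto simp: brick_def)
qed

text \<open>If the hole ever sees two colors, the length of the induced cycles decides between the
  two kinds of brick. Otherwise all edges at a vertex have a single color, and
  \<open>card_le\<close> bounds their number.\<close>

theorem brick_or_degree_le:
  assumes St: "St v0 \<phi>0" and v0: "v0 \<in> verts B"
  shows "brick B \<or> (\<forall>v\<in>verts B. degree B v \<le> r)"
proof (cases "\<exists>v \<phi> a b. St v \<phi> \<and> adj B v a \<and> adj B v b \<and> \<phi> a \<noteq> \<phi> b")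
  case True
  then obtain v \<phi> a b where *: "St v \<phi>" "adj B v a" "adj B v b" "\<phi> a \<noteq> \<phi> b" by blast
  show ?thesis
  proof (cases "\<exists>n p \<phi>. induced_cycle B n p \<and> St (p 0) \<phi> \<and> \<phi> (p 1) \<noteq> \<phi> (p 2) \<and> n \<ge> 4")
    case True
    then show ?thesis using long_cycle_brick by blast
  next
    case False
    then show ?thesis using complete_brick[OF _ *] by (meson not_le)
  qed
next
  case mono: False
  have "degree B v \<le> r" if v: "v \<in> verts B" for v
  proof -
    have "\<exists>\<phi>. St v \<phi>"
      using conn[OF v0 v]
    proof (induction rule: rtranclp_induct)
      case (step y z)
      then show ?case using shift by blast
    qed (use St in blast)
    then obtain \<phi> where \<phi>: "St v \<phi>" ..
    show ?thesis
    proof (cases "\<exists>a. adj B v a")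
      case True
      then obtain a where a: "adj B v a" ..
      have "{e \<in> edges B. v \<in> inc B e} \<subseteq> colored_edges B v \<phi> (\<phi> a)"
      proof
        fix e assume e: "e \<in> {e \<in> edges B. v \<in> inc B e}"
        then obtain x y where "x \<in> inc B e" "y \<in> inc B e" "adj B x y"
          using edge_two_vertices[OF hyp, of e] by blast
        then obtain u where "u \<in> inc B e" "u \<noteq> v" by (metis adj_irrefl)
        moreover from this have "adj B v u" using e by (auto simp: adj_def)
        then have "\<phi> u = \<phi> a" using mono \<phi> a by blast
        ultimately show "e \<in> colored_edges B v \<phi> (\<phi> a)"
          using e by (auto simp: colored_edges_def)
      qed
      then have "degree B v \<le> card (colored_edges B v \<phi> (\<phi> a))"
        using hyp unfolding degree_def
        by (intro card_mono) (auto simp: colored_edges_def hypergraph_def)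
      then show ?thesis using card_le[OF \<phi>, of "\<phi> a"] by simp
    next
      case False
      have "{e \<in> edges B. v \<in> inc B e} = {}"
      proof (rule ccontr)
        assume "{e \<in> edges B. v \<in> inc B e} \<noteq> {}"
        then obtain e where e: "e \<in> edges B" "v \<in> inc B e" by blast
        then obtain x y where "x \<in> inc B e" "y \<in> inc B e" "adj B x y"
          using edge_two_vertices[OF hyp, of e] by blast
        then obtain u where "u \<in> inc B e" "u \<noteq> v" by (metis adj_irrefl)
        then show False using False e by (auto simp: adj_def)
      qed
      then show ?thesis by (simp only: degree_def card.empty)
    qed
  qed
  then show ?thesis by blast
qed

end

section \<open>Connectivity of blocks\<close>

text \<open>A shortest walk repeats neither vertices nor edges.\<close>

lemma hyper_connected_iff:
  "hyper_connected G \<longleftrightarrow> (\<forall>u\<in>verts G. \<forall>v\<in>verts G. (adj G)\<^sup>*\<^sup>* u v)" if "hypergraph G"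
proof
  assume c: "hyper_connected G"
  show "\<forall>u\<in>verts G. \<forall>v\<in>verts G. (adj G)\<^sup>*\<^sup>* u v"
  proof (intro ballI)
    fix u v assume "u \<in> verts G" "v \<in> verts G"
    then obtain vs es where h: "hyperpath G vs es" "hd vs = u" "last vs = v"
      using c unfolding hyper_connected_def by blast
    then have len: "length vs = length es + 1" and dist: "distinct vs" and es: "set es \<subseteq> edges G"
      and step: "\<And>j. j < length es \<Longrightarrow> {vs ! j, vs ! (j + 1)} \<subseteq> inc G (es ! j)"
      by (auto simp: hyperpath_def)
    have reach: "j \<le> length es \<Longrightarrow> (adj G)\<^sup>*\<^sup>* (vs ! 0) (vs ! j)" for j
    proof (induction j)
      case (Suc j)
      have "adj G (vs ! j) (vs ! Suc j)"
        unfolding adj_def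
      proof
        show "vs ! j \<noteq> vs ! Suc j"
          using Suc.prems dist len by (simp add: nth_eq_iff_index_eq)
        have "es ! j \<in> edges G" using Suc.prems es by auto
        then show "\<exists>e\<in>edges G. vs ! j \<in> inc G e \<and> vs ! Suc j \<in> inc G e"
          using step[of j] Suc.prems by auto
      qed
      then show ?case using Suc by (meson Suc_leD rtranclp.rtrancl_into_rtrancl)
    qed simp
    have "vs \<noteq> []" using len by auto
    then have "vs ! 0 = u" "vs ! length es = v"
      using h(2,3) len by (simp_all add: hd_conv_nth last_conv_nth)
    then show "(adj G)\<^sup>*\<^sup>* u v" using reach[of "length es"] by simp
  qed
next
  assume c: "\<forall>u\<in>verts G. \<forall>v\<in>verts G. (adj G)\<^sup>*\<^sup>* u v"
  show "hyper_connected G"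
    unfolding hyper_connected_def
  proof (intro ballI)
    fix u v assume uv: "u \<in> verts G" "v \<in> verts G"
    define W where "W k p e \<longleftrightarrow> p 0 = u \<and> p k = v \<and>
      (\<forall>i<k. e i \<in> edges G \<and> p i \<in> inc G (e i) \<and> p (Suc i) \<in> inc G (e i))"
      for k and p :: "nat \<Rightarrow> 'a" and e :: "nat \<Rightarrow> 'b"
    have "\<exists>k p e. p 0 = u \<and> p k = w \<and>
      (\<forall>i<k. e i \<in> edges G \<and> p i \<in> inc G (e i) \<and> p (Suc i) \<in> inc G (e i))"
      if "(adj G)\<^sup>*\<^sup>* u w" for w
      using that
    proof (induction rule: rtranclp_induct)
      case base
      show ?case by (intro exI[of _ 0] exI[of _ "\<lambda>_. u"]) auto
    next
      case (step y z)
      then obtain k p e where p: "p 0 = u" "p k = y"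
        "\<forall>i<k. e i \<in> edges G \<and> p i \<in> inc G (e i) \<and> p (Suc i) \<in> inc G (e i)" by blast
      obtain d where "d \<in> edges G" "y \<in> inc G d" "z \<in> inc G d"
        using step.hyps(2) by (auto simp: adj_def)
      then show ?case
        using p by (intro exI[of _ "Suc k"] exI[of _ "p(Suc k := z)"] exI[of _ "e(k := d)"])
          (auto simp: less_Suc_eq)
    qed
    from this[of v] have ex: "\<exists>k. \<exists>p e. W k p e"
      using c uv unfolding W_def by blast
    define k where "k = (LEAST k. \<exists>p e. W k p e)"
    obtain p e where W: "W k p e" using LeastI_ex[OF ex] unfolding k_def by blast
    have min: "k \<le> l" if "W l q d" for l q d
      using Least_le[of "\<lambda>k. \<exists>p e. W k p e" l] that unfolding k_def by blast
    have p0: "p 0 = u" "p k = v" and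
      pe: "\<And>i. i < k \<Longrightarrow> e i \<in> edges G \<and> p i \<in> inc G (e i) \<and> p (Suc i) \<in> inc G (e i)"
      using W by (auto simp: W_def)
    have pinj: "p i \<noteq> p j" if "i < j" "j \<le> k" for i j
    proof
      assume eq: "p i = p j"
      let ?d = "j - i"
      \<comment> \<open>A repeated vertex: the walk leaves \<open>p i\<close> at once by the edge
        \<open>e j\<close>.\<close>
      have "W (k - ?d) (\<lambda>l. if l \<le> i then p l else p (l + ?d)) (\<lambda>l. if l < i then e l else e (l + ?d))"
        unfolding W_def
      proof (intro conjI allI impI)
        show "(if k - ?d \<le> i then p (k - ?d) else p (k - ?d + ?d)) = v"
          using that eq p0 by (cases "j = k") auto
      next
        fix l assume l: "l < k - ?d"
        let ?e = "if l < i then e l else e (l + ?d)"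
        show "?e \<in> edges G" using pe[of l] pe[of "l + ?d"] l that by auto
        show "(if l \<le> i then p l else p (l + ?d)) \<in> inc G ?e"
          using pe[of l] pe[of "l + ?d"] l that eq by (cases "l = i") auto
        show "(if Suc l \<le> i then p (Suc l) else p (Suc l + ?d)) \<in> inc G ?e"
          using pe[of l] pe[of "l + ?d"] l that by auto
      qed (use p0 in simp)
      from min[OF this] that show False by simp
    qed
    have einj: "e i \<noteq> e j" if "i < j" "j < k" for i j
    proof
      assume eq: "e i = e j"
      let ?d = "j - i"
      \<comment> \<open>A repeated edge contains both \<open>p i\<close> and
        \<open>p (Suc j)\<close>, so using it once suffices.\<close>
      have "W (k - ?d) (\<lambda>l. if l \<le> i then p l else p (l + ?d)) (\<lambda>l. if l \<le> i then e l else e (l + ?d))"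
        unfolding W_def
      proof (intro conjI allI impI)
        show "(if k - ?d \<le> i then p (k - ?d) else p (k - ?d + ?d)) = v"
          using that p0 by auto
      next
        fix l assume l: "l < k - ?d"
        let ?e = "if l \<le> i then e l else e (l + ?d)"
        show "?e \<in> edges G" using pe[of l] pe[of "l + ?d"] l that by auto
        show "(if l \<le> i then p l else p (l + ?d)) \<in> inc G ?e"
          using pe[of l] pe[of "l + ?d"] l that by auto
        show "(if Suc l \<le> i then p (Suc l) else p (Suc l + ?d)) \<in> inc G ?e"
          using pe[of l] pe[of "l + ?d"] l that eq by (cases "l = i") auto
      qed (use p0 in simp)
      from min[OF this] that show False by simp
    qed
    have pV: "p i \<in> verts G" if "i \<le> k" for i
    proof (cases i)
      case (Suc j)
      then show ?thesis using pe[of j] that \<open>hypergraph G\<close> by (auto simp: hypergraph_def)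
    qed (use p0 uv in simp)
    let ?vs = "map p [0..<Suc k]" and ?es = "map e [0..<k]"
    have "inj_on p {0..<Suc k}" "inj_on e {0..<k}"
      using pinj einj by (auto simp: inj_on_def less_Suc_eq_le) (metis linorder_neqE_nat)+
    then have "hyperpath G ?vs ?es"
      using pV pe unfolding hyperpath_def
      by (auto simp: distinct_map nth_append less_Suc_eq_le simp del: upt_Suc)
    moreover have "hd ?vs = u" "last ?vs = v"
      using p0 by (simp_all add: hd_conv_nth last_conv_nth nth_map nth_upt del: upt_Suc)
    ultimately show "\<exists>vs es. hyperpath G vs es \<and> hd vs = u \<and> last vs = v" by blast
  qed
qed

lemma separating_vertexI:
  assumes "hypergraph G" "X \<union> Y = verts G" "X \<inter> Y = {v}" "x \<in> X" "x \<noteq> v" "y \<in> Y" "y \<noteq> v"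
    and "\<And>e. e \<in> edges G \<Longrightarrow> inc G e \<subseteq> X \<or> inc G e \<subseteq> Y"
  shows "separating_vertex G v"
proof -
  have fin: "finite X" "finite Y"
    using assms(1,2) by (metis finite_Un hypergraph_def)+
  have "{x, v} \<subseteq> X" "{y, v} \<subseteq> Y" using assms by auto
  then have "card X \<ge> 2" "card Y \<ge> 2"
    using card_mono[OF fin(1), of "{x, v}"] card_mono[OF fin(2), of "{y, v}"] assms by auto
  then show ?thesis
    using assms unfolding separating_vertex_def
    by (intro exI[of _ X] exI[of _ Y]) (auto simp: induced_def)
qed

lemma separating_vertexE:
  assumes "hypergraph G" "separating_vertex G v"
  obtains X Y x y where "X \<union> Y = verts G" "X \<inter> Y = {v}" "x \<in> X" "x \<noteq> v" "y \<in> Y" "y \<noteq> v"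
    "\<forall>e\<in>edges G. inc G e \<subseteq> X \<or> inc G e \<subseteq> Y"
proof -
  obtain X Y where XY: "X \<subseteq> verts G" "Y \<subseteq> verts G" "verts G = X \<union> Y"
    "edges G = edges (induced G X) \<union> edges (induced G Y)" "X \<inter> Y = {v}" "card X \<ge> 2" "card Y \<ge> 2"
    using assms(2) unfolding separating_vertex_def by (auto simp: induced_def)
  have "\<exists>x\<in>Z. x \<noteq> v" if "card Z \<ge> 2" for Z :: "'a set"
  proof (rule ccontr)
    assume "\<not> (\<exists>x\<in>Z. x \<noteq> v)"
    then have "card Z \<le> card {v}" by (intro card_mono) auto
    then show False using that by simp
  qed
  then obtain x y where "x \<in> X" "x \<noteq> v" "y \<in> Y" "y \<noteq> v" using XY by metis
  moreover have "inc G e \<subseteq> X \<or> inc G e \<subseteq> Y" if "e \<in> edges G" for e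
    using XY(4) that by (auto simp: induced_def)
  ultimately show ?thesis using that[of X Y] XY by auto
qed

text \<open>Otherwise let \<open>R\<close> be the set of vertices reached from \<open>u\<close>. No
  edge joins \<open>R\<close> to a vertex outside \<open>R\<close> other than \<open>x\<close>, so
  \<open>R\<close> with \<open>x\<close> added and the complement of \<open>R\<close> separate
  \<open>G\<close> at \<open>x\<close>.\<close>

lemma connected_nonseparable_avoiding:
  assumes hyp: "hypergraph G" and cn: "connected_nonseparable G"
    and x: "x \<in> verts G" "u \<in> verts G" "w \<in> verts G" "u \<noteq> x" "w \<noteq> x"
  shows "(adj_avoiding G x)\<^sup>*\<^sup>* u w"
proof (rule ccontr)
  assume no: "\<not> (adj_avoiding G x)\<^sup>*\<^sup>* u w"
  define R where "R = {v \<in> verts G. v \<noteq> x \<and> (adj_avoiding G x)\<^sup>*\<^sup>* u v}"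
  have "separating_vertex G x"
  proof (rule separating_vertexI[OF hyp])
    show "insert x R \<union> (verts G - R) = verts G" "insert x R \<inter> (verts G - R) = {x}"
      using x by (auto simp: R_def)
    show "u \<in> insert x R" "u \<noteq> x" "w \<in> verts G - R" "w \<noteq> x"
      using x no by (auto simp: R_def)
    show "inc G e \<subseteq> insert x R \<or> inc G e \<subseteq> verts G - R" if e: "e \<in> edges G" for e
    proof (rule ccontr)
      assume "\<not> ?thesis"
      moreover have "inc G e \<subseteq> verts G" using e hyp by (simp add: hypergraph_def)
      ultimately obtain a b where ab: "a \<in> inc G e" "a \<noteq> x" "a \<notin> R" "b \<in> inc G e" "b \<in> R"
        "a \<in> verts G"
        by blast
      then have "adj_avoiding G x b a"
        using e by (auto simp: adj_avoiding_def adj_def R_def)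
      then have "a \<in> R"
        using ab by (auto simp: R_def intro: rtranclp.rtrancl_into_rtrancl)
      then show False using ab by simp
    qed
  qed
  then show False using cn x(1) by (auto simp: connected_nonseparable_def)
qed

lemma adj_rtrancl_split:
  assumes "(adj G)\<^sup>*\<^sup>* u w" "u \<in> X" "w \<notin> X"
  obtains e a b where "e \<in> edges G" "a \<in> inc G e" "a \<in> X" "b \<in> inc G e" "b \<notin> X"
proof -
  have "w \<in> X \<or> (\<exists>e\<in>edges G. \<exists>a\<in>inc G e. \<exists>b\<in>inc G e. a \<in> X \<and> b \<notin> X)"
    using assms(1)
  proof (induction rule: rtranclp_induct)
    case (step y z)
    then show ?case unfolding adj_def by blast
  qed (use assms(2) in simp)
  then show ?thesis using that assms(3) by blast
qed

text \<open>By maximality it suffices that \<open>B\<close> with \<open>e\<close> added stays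
  connected and without separating vertex. As \<open>e\<close> meets \<open>B\<close> in two
  vertices and lies on one side of any separation, the separation would restrict to
  \<open>B\<close>.\<close>

lemma block_edge:
  assumes hyp: "hypergraph G" and bl: "block G B" and e: "e \<in> edges G"
    and uw: "u \<in> inc G e" "w \<in> inc G e" "u \<noteq> w" "u \<in> verts B" "w \<in> verts B"
  shows "e \<in> edges B"
proof -
  have sub: "subhypergraph B G" and cn: "connected_nonseparable B"
    and max: "\<And>B'. subhypergraph B' G \<Longrightarrow> connected_nonseparable B' \<Longrightarrow> subhypergraph B B' \<Longrightarrow>
      subhypergraph B' B"
    using bl unfolding block_def by auto
  have hypB: "hypergraph B" using sub by (simp add: subhypergraph_def)
  have incB: "inc B d = inc G d" if "d \<in> edges B" for d
    using sub that by (simp add: subhypergraph_def)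
  define B' where "B' = \<lparr>verts = verts B \<union> inc G e, edges = insert e (edges B), inc = inc G\<rparr>"
  have sel: "verts B' = verts B \<union> inc G e" "edges B' = insert e (edges B)" "inc B' = inc G"
    by (simp_all add: B'_def)
  have eV: "inc G e \<subseteq> verts G" "card (inc G e) \<ge> 2" "finite (inc G e)"
    using hyp e finite_subset by (auto simp: hypergraph_def)
  have hyp': "hypergraph B'"
    using hypB eV incB by (auto simp: hypergraph_def sel)
  have sub': "subhypergraph B' G" "subhypergraph B B'"
    using sub hyp' hypB eV e by (auto simp: subhypergraph_def sel)
  have adj': "adj B' a b" if "adj B a b" for a b
    using that incB by (auto simp: adj_def sel)
  have connB: "(adj B)\<^sup>*\<^sup>* a b" if "a \<in> verts B" "b \<in> verts B" for a b
    using cn that unfolding connected_nonseparable_def hyper_connected_iff[OF hypB] by blast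
  have connB': "(adj B')\<^sup>*\<^sup>* a b" if "a \<in> verts B" "b \<in> verts B" for a b
    using connB[OF that] by (rule rtranclp_mono[THEN predicate2D, rotated]) (use adj' in auto)
  have e': "(adj B')\<^sup>*\<^sup>* a u \<and> (adj B')\<^sup>*\<^sup>* u a" if "a \<in> inc G e" for a
  proof (cases "a = u")
    case False
    then have "adj B' a u" "adj B' u a" using that uw by (auto simp: adj_def sel)
    then show ?thesis by blast
  qed simp
  have hub: "(adj B')\<^sup>*\<^sup>* a u \<and> (adj B')\<^sup>*\<^sup>* u a" if "a \<in> verts B'" for a
    using that e' connB' uw by (auto simp: sel)
  have "hyper_connected B'"
    unfolding hyper_connected_iff[OF hyp'] using hub by (meson rtranclp_trans)
  moreover have "\<not> separating_vertex B' v" for v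
  proof
    assume sep: "separating_vertex B' v"
    obtain X Y x y where XY: "X \<union> Y = verts B'" "X \<inter> Y = {v}" "x \<in> X" "x \<noteq> v" "y \<in> Y" "y \<noteq> v"
      "\<forall>d\<in>edges B'. inc B' d \<subseteq> X \<or> inc B' d \<subseteq> Y"
      using separating_vertexE[OF hyp' sep] .
    \<comment> \<open>\<open>X\<close> names the side that contains \<open>e\<close>; both orders
      are used at the end.\<close>
    have no: False if X: "X \<union> Y = verts B'" "X \<inter> Y = {v}" "inc G e \<subseteq> X" "y \<in> Y" "y \<noteq> v"
      "\<And>d. d \<in> edges B' \<Longrightarrow> inc B' d \<subseteq> X \<or> inc B' d \<subseteq> Y" for X Y y
    proof -
      obtain x where x: "x \<in> X" "x \<noteq> v" "x \<in> verts B" using uw X(3) by blast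
      have y: "y \<in> verts B" "y \<notin> X" using X by (auto simp: sel)
      have split: "inc B d \<subseteq> X \<inter> verts B \<or> inc B d \<subseteq> Y \<inter> verts B" if d: "d \<in> edges B" for d
      proof -
        have "inc B d \<subseteq> verts B" using d hypB by (simp add: hypergraph_def)
        then show ?thesis using X(6)[of d] d incB[OF d] by (auto simp: sel)
      qed
      show False
      proof (cases "v \<in> verts B")
        case True
        have "separating_vertex B v"
          by (rule separating_vertexI[OF hypB, of "X \<inter> verts B" "Y \<inter> verts B" v x y])
            (use X x y True split in \<open>auto simp: sel\<close>)
        then show False using cn True by (auto simp: connected_nonseparable_def)
      next
        \<comment> \<open>With \<open>v\<close> outside \<open>B\<close> the two sides are disjoint
          within \<open>B\<close>, against its connectivity.\<close>
        case False
        obtain d a b where d: "d \<in> edges B" "a \<in> inc B d" "a \<in> X" "b \<in> inc B d" "b \<notin> X"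
          using adj_rtrancl_split[OF connB[OF x(3) y(1)] x(1) y(2)] .
        then have "a \<in> X \<inter> Y" "a \<in> verts B" using split[OF d(1)] by auto
        then show False using X(2) False by simp
      qed
    qed
    have "inc G e \<subseteq> X \<or> inc G e \<subseteq> Y" using XY(7) by (simp add: sel)
    then show False
    proof
      assume "inc G e \<subseteq> X"
      then show False using no[of X Y y] XY by blast
    next
      assume "inc G e \<subseteq> Y"
      then show False using no[of Y X x] XY by blast
    qed
  qed
  ultimately have "subhypergraph B' B"
    using max sub' by (auto simp: connected_nonseparable_def)
  then show ?thesis by (auto simp: subhypergraph_def sel)
qed

section \<open>Smooth properties\<close>

lemma hyper_iso_same:
  assumes "verts G = verts H" "edges G = edges H" "\<And>e. e \<in> edges G \<Longrightarrow> inc G e = inc H e"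
  shows "hyper_iso G H"
  unfolding hyper_iso_def using assms by (intro exI[of _ id]) auto

lemma hypergraph_induced:
  "hypergraph H \<Longrightarrow> X \<subseteq> verts H \<Longrightarrow> hypergraph (induced H X)"
  by (auto simp: hypergraph_def induced_def finite_subset)

lemma induced_induced [simp]: "Y \<subseteq> X \<Longrightarrow> induced (induced H X) Y = induced H Y"
  by (auto simp: induced_def)

lemma verts_induced [simp]: "verts (induced H X) = X"
  by (simp add: induced_def)

lemma minimal_forbidden_induced:
  fixes P :: "('v::infinite, 'e::infinite) hypergraph set"
  assumes H: "hypergraph H" "X \<subseteq> verts H" "induced H X \<notin> P"
  obtains K where "K \<subseteq> X" "induced H K \<in> minimal_forbidden P"
proof -
  have fin: "finite X" using H finite_subset by (auto simp: hypergraph_def)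
  let ?A = "{K. K \<subseteq> X \<and> induced H K \<notin> P}"
  have "finite ?A" "?A \<noteq> {}" using fin H by auto
  then obtain K where "K \<in> ?A" "\<forall>K'\<in>?A. K' \<subseteq> K \<longrightarrow> K = K'"
    using finite_has_minimal[of ?A] by blast
  then have K: "K \<subseteq> X" "induced H K \<notin> P"
    and min: "\<And>K'. K' \<subseteq> K \<Longrightarrow> induced H K' \<notin> P \<Longrightarrow> K = K'"
    by auto
  have "del_vert (induced H K) v \<in> P" if "v \<in> K" for v
    using min[of "K - {v}"] K that by (auto simp: del_vert_def)
  then have "induced H K \<in> minimal_forbidden P"
    using K H by (auto simp: minimal_forbidden_def intro: hypergraph_induced)
  then show ?thesis using that K by blast
qed

lemma degree_minimal_forbidden:
  fixes P :: "('v::infinite, 'e::infinite) hypergraph set"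
  assumes "K \<in> minimal_forbidden P" "v \<in> verts K"
  shows "prop_degree P \<le> degree K v"
proof -
  have "prop_degree P \<le> min_degree K"
    unfolding prop_degree_def using assms(1) by (simp add: cInf_lower)
  also have "\<dots> \<le> degree K v"
    using assms by (auto simp: min_degree_def minimal_forbidden_def hypergraph_def)
  finally show ?thesis .
qed

lemma degree_induced:
  "degree (induced H K) v = card {e \<in> edges H. v \<in> inc H e \<and> inc H e \<subseteq> K}"
  by (simp add: degree_def induced_def conj_ac)

text \<open>A minimal forbidden part of \<open>X\<close> that missed \<open>v\<close> would lie
  inside \<open>X - {v}\<close> and so belong to \<open>P\<close>. Hence it contains
  \<open>v\<close>, with degree at least \<open>prop_degree P\<close>.\<close>

lemma forbidden_witness:
  fixes P :: "('v::infinite, 'e::infinite) hypergraph set"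
  assumes P: "hereditary P" and H: "hypergraph H" "X \<subseteq> verts H"
    and X: "induced H X \<notin> P" "induced H (X - {v}) \<in> P"
  obtains K where "K \<subseteq> X" "v \<in> K"
    "prop_degree P \<le> card {e \<in> edges H. v \<in> inc H e \<and> inc H e \<subseteq> K}"
proof -
  obtain K where K: "K \<subseteq> X" "induced H K \<in> minimal_forbidden P"
    using minimal_forbidden_induced[OF H X(1)] .
  have "v \<in> K"
  proof (rule ccontr)
    assume "v \<notin> K"
    then have "K \<subseteq> X - {v}" using K by blast
    then have "induced (induced H (X - {v})) K \<in> P"
      using P X(2) unfolding hereditary_def by auto
    then show False using K \<open>K \<subseteq> X - {v}\<close> by (simp add: minimal_forbidden_def)
  qed
  then show ?thesis
    using that[of K] K degree_minimal_forbidden[OF K(2), of v] by (simp add: degree_induced)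
qed

text \<open>If \<open>B\<close> is not in \<open>P\<close>, it has a minimal forbidden induced part
  \<open>K\<close>. Its degrees already reach \<open>prop_degree P\<close>, so no edge leaves
  \<open>K\<close>, and connectivity gives \<open>K = verts B\<close>.\<close>

lemma connected_degree_le:
  fixes P :: "('v::infinite, 'e::infinite) hypergraph set"
  assumes P: "smooth P" and hyp: "hypergraph B" and conn: "hyper_connected B"
    and deg: "\<And>v. v \<in> verts B \<Longrightarrow> degree B v \<le> prop_degree P"
  shows "(B \<in> minimal_forbidden P \<and> regular (prop_degree P) B) \<or>
    (B \<in> P \<and> max_degree B \<le> prop_degree P)"
proof (cases "B \<in> P")
  case True
  have "max_degree B \<le> prop_degree P"
    using deg hyp by (auto simp: max_degree_def hypergraph_def)
  then show ?thesis using True by blast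
next
  case False
  have iso: "G' \<in> P" if "G \<in> P" "hypergraph G'" "hyper_iso G G'" for G G'
    using P that unfolding smooth_def hypergraph_property_def by blast
  have B: "induced B (verts B) = B"
    by (rule hypergraph.equality) (use hyp in \<open>auto simp: induced_def hypergraph_def\<close>)
  then have "induced B (verts B) \<notin> P" using False by simp
  then obtain K where K: "K \<subseteq> verts B" "induced B K \<in> minimal_forbidden P"
    using minimal_forbidden_induced[OF hyp] by blast
  have fin: "finite (edges B)" using hyp by (simp add: hypergraph_def)
  have full: "degree B v = prop_degree P \<and> (\<forall>e\<in>edges B. v \<in> inc B e \<longrightarrow> inc B e \<subseteq> K)" if v: "v \<in> K" for v
  proof -
    let ?A = "{e \<in> edges B. v \<in> inc B e \<and> inc B e \<subseteq> K}" and ?D = "{e \<in> edges B. v \<in> inc B e}"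
    have "prop_degree P \<le> card ?A"
      using degree_minimal_forbidden[OF K(2), of v] v by (simp add: degree_induced)
    moreover have "card ?A \<le> card ?D" using fin by (intro card_mono) auto
    moreover have "card ?D \<le> prop_degree P" using deg v K by (auto simp: degree_def)
    ultimately have "card ?A = card ?D" "card ?D = prop_degree P" by auto
    moreover from this have "?A = ?D" using fin by (intro card_subset_eq) auto
    ultimately show ?thesis by (auto simp: degree_def)
  qed
  \<comment> \<open>The empty hypergraph is in \<open>P\<close>. Empty restrictions of
    \<open>G\<close> and \<open>B\<close> may differ in \<open>inc\<close>, so closure under
    isomorphism is needed to pass between them.\<close>
  have ne: "K \<noteq> {}"
  proof
    assume "K = {}"
    obtain G where G: "G \<in> P" using P unfolding smooth_def nontrivial_def by blast
    have "hypergraph G"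
      using P G unfolding smooth_def hypergraph_property_def by blast
    have "induced G {} \<in> P"
      using P G unfolding smooth_def hereditary_def by simp
    have emp: "edges (induced F {}) = {}" if "hypergraph F" for F :: "('v, 'e) hypergraph"
      using that by (fastforce simp: induced_def hypergraph_def)
    have "induced B {} \<in> P"
      by (rule iso[OF \<open>induced G {} \<in> P\<close> hypergraph_induced[OF hyp] hyper_iso_same])
        (use emp[OF hyp] emp[OF \<open>hypergraph G\<close>] in auto)
    then show False using K \<open>K = {}\<close> by (simp add: minimal_forbidden_def)
  qed
  have "K = verts B"
  proof (rule ccontr)
    assume "K \<noteq> verts B"
    then obtain u w where uw: "u \<in> K" "w \<in> verts B" "w \<notin> K" using ne K by blast
    then have uw': "(adj B)\<^sup>*\<^sup>* u w"
      using conn K unfolding hyper_connected_iff[OF hyp] by blast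
    obtain e a b where "e \<in> edges B" "a \<in> inc B e" "a \<in> K" "b \<in> inc B e" "b \<notin> K"
      using adj_rtrancl_split[OF uw' uw(1,3)] .
    then show False using full by blast
  qed
  then have "B \<in> minimal_forbidden P" "regular (prop_degree P) B"
    using K(2) full False hyp by (auto simp: regular_def B)
  then show ?thesis by blast
qed

section \<open>Low vertices of critical hypergraphs\<close>

text \<open>The edges that become monochromatic once \<open>v\<close> receives \<open>c\<close>. The
  quantifier is universal, unlike in \<open>colored_edges\<close>, because edges of \<open>H\<close>
  at \<open>v\<close> are not known beforehand to be monochromatic apart from
  \<open>v\<close>.\<close>

definition mono_edges :: "('v, 'e) hypergraph \<Rightarrow> 'v \<Rightarrow> ('v \<Rightarrow> 'c) \<Rightarrow> 'c \<Rightarrow> 'e set" where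
  "mono_edges H v \<phi> c = {e \<in> edges H. v \<in> inc H e \<and> (\<forall>u\<in>inc H e - {v}. \<phi> u = c)}"

lemma list_coloring_del_vert:
  "list_coloring P C L (del_vert H v) \<phi> \<longleftrightarrow> (\<forall>w\<in>verts H - {v}. \<phi> w \<in> C \<and> \<phi> w \<in> L w) \<and>
    (\<forall>c\<in>C. induced H {w \<in> verts H - {v}. \<phi> w = c} \<in> P)"
proof -
  have "induced (del_vert H v) {w \<in> verts H - {v}. \<phi> w = c} = induced H {w \<in> verts H - {v}. \<phi> w = c}"
    for c
    unfolding del_vert_def by (rule induced_induced) blast
  then show ?thesis
    by (simp add: list_coloring_def del_vert_def)
qed

lemma uncolorable_class:
  fixes P :: "('v::infinite, 'e::infinite) hypergraph set"
  assumes no: "\<not> (\<exists>\<chi>. list_coloring P C L H \<chi>)" and \<phi>: "list_coloring P C L (del_vert H v) \<phi>"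
    and v: "v \<in> verts H" and c: "c \<in> L v" "c \<in> C"
  shows "induced H (insert v {w \<in> verts H - {v}. \<phi> w = c}) \<notin> P"
proof
  assume P: "induced H (insert v {w \<in> verts H - {v}. \<phi> w = c}) \<in> P"
  have "induced H {w \<in> verts H. (\<phi>(v := c)) w = d} \<in> P" if "d \<in> C" for d
  proof (cases "d = c")
    case True
    have "{w \<in> verts H. (\<phi>(v := c)) w = c} = insert v {w \<in> verts H - {v}. \<phi> w = c}"
      using v by auto
    then show ?thesis using P True by simp
  next
    case False
    then have "{w \<in> verts H. (\<phi>(v := c)) w = d} = {w \<in> verts H - {v}. \<phi> w = d}" by auto
    then show ?thesis using \<phi> that by (simp add: list_coloring_del_vert)
  qed
  then have "list_coloring P C L H (\<phi>(v := c))"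
    using \<phi> c unfolding list_coloring_del_vert by (auto simp: list_coloring_def)
  then show False using no by blast
qed

text \<open>Giving \<open>v\<close> the color \<open>c\<close> must create a forbidden part through
  \<open>v\<close>, and all its edges at \<open>v\<close> lie in \<open>mono_edges\<close>.\<close>

lemma mono_edges_ge:
  fixes P :: "('v::infinite, 'e::infinite) hypergraph set"
  assumes P: "hereditary P" and H: "hypergraph H"
    and no: "\<not> (\<exists>\<chi>. list_coloring P C L H \<chi>)" and \<phi>: "list_coloring P C L (del_vert H v) \<phi>"
    and v: "v \<in> verts H" and c: "c \<in> L v" "c \<in> C"
  shows "prop_degree P \<le> card (mono_edges H v \<phi> c)"
proof -
  let ?X = "insert v {w \<in> verts H - {v}. \<phi> w = c}"
  have "?X - {v} = {w \<in> verts H - {v}. \<phi> w = c}" by blast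
  then have rest: "induced H (?X - {v}) \<in> P"
    using \<phi> c(2) by (simp only: list_coloring_del_vert)
  have X: "?X \<subseteq> verts H" using v by auto
  obtain K where K: "K \<subseteq> ?X" "v \<in> K"
    "prop_degree P \<le> card {e \<in> edges H. v \<in> inc H e \<and> inc H e \<subseteq> K}"
    using forbidden_witness[OF P H X uncolorable_class[where ?P = P, OF no \<phi> v c] rest] .
  have "{e \<in> edges H. v \<in> inc H e \<and> inc H e \<subseteq> K} \<subseteq> mono_edges H v \<phi> c"
    using K(1) by (auto simp: mono_edges_def)
  then have "card {e \<in> edges H. v \<in> inc H e \<and> inc H e \<subseteq> K} \<le> card (mono_edges H v \<phi> c)"
    using H by (intro card_mono) (auto simp: mono_edges_def hypergraph_def)
  then show ?thesis using K(3) by simp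
qed

lemma edge_other_vertex:
  assumes "hypergraph G" "e \<in> edges G"
  obtains u where "u \<in> inc G e" "u \<noteq> v"
  using edge_two_vertices[OF assms] by (metis adj_irrefl)

text \<open>The sets \<open>mono_edges H v \<phi> c\<close> for \<open>c\<close> in
  \<open>L v\<close> are disjoint and have at least \<open>prop_degree P\<close> elements each. The
  degree of a low vertex leaves room for no more, so all bounds are tight and every edge at
  \<open>v\<close> is covered.\<close>

lemma low_vertex_edges:
  fixes P :: "('v::infinite, 'e::infinite) hypergraph set"
  assumes P: "hereditary P" and H: "hypergraph H"
    and no: "\<not> (\<exists>\<chi>. list_coloring P C L H \<chi>)" and \<phi>: "list_coloring P C L (del_vert H v) \<phi>"
    and v: "v \<in> low_vertices P L H" and L: "L v \<subseteq> C"
  shows "\<And>c. c \<in> L v \<Longrightarrow> card (mono_edges H v \<phi> c) = prop_degree P"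
    and "\<And>e. e \<in> edges H \<Longrightarrow> v \<in> inc H e \<Longrightarrow> \<exists>c\<in>L v. e \<in> mono_edges H v \<phi> c"
proof -
  let ?T = "mono_edges H v \<phi>" and ?r = "prop_degree P" and ?D = "{e \<in> edges H. v \<in> inc H e}"
  have vH: "v \<in> verts H" and fin: "finite (L v)" and deg: "card ?D = ?r * card (L v)"
    using v by (auto simp: low_vertices_def degree_def)
  have finH: "finite (edges H)" using H by (simp add: hypergraph_def)
  have finT: "finite (?T c)" for c using finH by (simp add: mono_edges_def)
  have ge: "?r \<le> card (?T c)" if "c \<in> L v" for c
    using mono_edges_ge[OF P H no \<phi> vH that] L that by blast
  have "?T c \<inter> ?T d = {}" if "c \<noteq> d" for c d
  proof (rule ccontr)
    assume "?T c \<inter> ?T d \<noteq> {}"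
    then obtain e where e: "e \<in> ?T c" "e \<in> ?T d" by blast
    then obtain u where "u \<in> inc H e" "u \<noteq> v"
      using edge_other_vertex[OF H, of e v] by (auto simp: mono_edges_def)
    then show False using e that by (auto simp: mono_edges_def)
  qed
  then have cardU: "card (\<Union>c\<in>L v. ?T c) = (\<Sum>c\<in>L v. card (?T c))"
    using fin finT by (intro card_UN_disjoint) auto
  have sub: "(\<Union>c\<in>L v. ?T c) \<subseteq> ?D" by (auto simp: mono_edges_def)
  have le: "(\<Sum>c\<in>L v. card (?T c)) \<le> (\<Sum>c\<in>L v. ?r)"
    using card_mono[OF _ sub] finH cardU deg by (simp add: mult.commute)
  show eq: "card (?T c) = ?r" if "c \<in> L v" for c
  proof (rule ccontr)
    assume "card (?T c) \<noteq> ?r"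
    then have "?r < card (?T c)" using ge[OF that] by simp
    then have "(\<Sum>c\<in>L v. ?r) < (\<Sum>c\<in>L v. card (?T c))"
      using ge that fin by (intro sum_strict_mono_ex1) auto
    then show False using le by simp
  qed
  have "card (\<Union>c\<in>L v. ?T c) = card ?D"
    using cardU eq deg by simp
  then have "(\<Union>c\<in>L v. ?T c) = ?D"
    using finH sub by (intro card_subset_eq) auto
  then show "\<exists>c\<in>L v. e \<in> ?T c" if "e \<in> edges H" "v \<in> inc H e" for e
    using that by blast
qed

text \<open>Exactly \<open>r\<close> edges join the low vertex \<open>v\<close> to each color class, so every forbidden subhypergraph
  created by giving \<open>v\<close> the color of \<open>u\<close> uses all of them, in particular the one through \<open>u\<close>.\<close>

lemma shift_coloring:
  fixes P :: "('v::infinite, 'e::infinite) hypergraph set"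
  assumes P: "hereditary P" and H: "hypergraph H"
    and no: "\<not> (\<exists>\<chi>. list_coloring P C L H \<chi>)" and \<phi>: "list_coloring P C L (del_vert H v) \<phi>"
    and v: "v \<in> low_vertices P L H" and L: "L v \<subseteq> C" and u: "adj H v u"
  shows "list_coloring P C L (del_vert H u) (\<phi>(v := \<phi> u))"
proof -
  note low = low_vertex_edges[OF P H no \<phi> v L]
  have vH: "v \<in> verts H" using v by (simp add: low_vertices_def)
  have uH: "u \<in> verts H" "u \<noteq> v" using adj_verts[OF H u] u by auto
  obtain e where e: "e \<in> edges H" "v \<in> inc H e" "u \<in> inc H e"
    using u by (auto simp: adj_def)
  obtain c where c: "c \<in> L v" "e \<in> mono_edges H v \<phi> c" using low(2)[OF e(1,2)] by blast
  then have cu: "\<phi> u = c" using e uH by (auto simp: mono_edges_def)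
  have "induced H {w \<in> verts H - {u}. (\<phi>(v := c)) w = d} \<in> P" if d: "d \<in> C" for d
  proof (cases "d = c")
    case False
    then have "{w \<in> verts H - {u}. (\<phi>(v := c)) w = d} = {w \<in> verts H - {v}. \<phi> w = d}"
      using cu vH by auto
    then show ?thesis using \<phi> d by (simp add: list_coloring_del_vert)
  next
    case True
    \<comment> \<open>The class of \<open>c\<close> gains \<open>v\<close> and loses
      \<open>u\<close>; without \<open>v\<close> it is part of an old class, so a forbidden part
      would have to contain \<open>v\<close>.\<close>
    let ?X = "{w \<in> verts H - {u}. (\<phi>(v := c)) w = c}"
    have "?X \<subseteq> verts H" by auto
    let ?Y = "{w \<in> verts H - {v}. \<phi> w = c}"
    have XY: "?X - {v} \<subseteq> ?Y" by auto
    have "induced H ?Y \<in> P"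
      using \<phi> d True by (simp add: list_coloring_del_vert)
    then have "induced (induced H ?Y) (?X - {v}) \<in> P"
      using P XY unfolding hereditary_def by (simp only: verts_induced)
    then have sub: "induced H (?X - {v}) \<in> P"
      by (simp only: induced_induced[OF XY])
    have "induced H ?X \<in> P"
    proof (rule ccontr)
      assume "induced H ?X \<notin> P"
      then obtain K where K: "K \<subseteq> ?X"
        "prop_degree P \<le> card {e \<in> edges H. v \<in> inc H e \<and> inc H e \<subseteq> K}"
        using forbidden_witness[OF P H \<open>?X \<subseteq> verts H\<close> _ sub] by blast
      have "{e \<in> edges H. v \<in> inc H e \<and> inc H e \<subseteq> K} \<subseteq> mono_edges H v \<phi> c"
      proof
        fix d assume d: "d \<in> {e \<in> edges H. v \<in> inc H e \<and> inc H e \<subseteq> K}"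
        then have "inc H d - {v} \<subseteq> ?Y" using K(1) XY by blast
        then have "\<forall>w\<in>inc H d - {v}. \<phi> w = c" by blast
        then show "d \<in> mono_edges H v \<phi> c" using d by (simp add: mono_edges_def)
      qed
      moreover have "finite (mono_edges H v \<phi> c)"
        using H by (simp add: mono_edges_def hypergraph_def)
      ultimately have "{e \<in> edges H. v \<in> inc H e \<and> inc H e \<subseteq> K} = mono_edges H v \<phi> c"
        using K(2) low(1)[OF c(1)] by (metis card_mono card_subset_eq le_antisym)
      then have "u \<in> K" using c(2) e(3) by blast
      then show False using K(1) by auto
    qed
    then show ?thesis using True by simp
  qed
  then show ?thesis
    using \<phi> c L cu unfolding list_coloring_del_vert by auto
qed

theorem theorem1p3:
  fixes P :: "('v::infinite, 'e::infinite) hypergraph set"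
    and H F B :: "('v, 'e) hypergraph"
    and C :: "'c set" and L :: "'v \<Rightarrow> 'c set" and r :: nat
  assumes "smooth P" and "prop_degree P = r"
    and "hypergraph H" and "verts H \<noteq> {}"
    and "list_assignment H C L" and "list_critical P C L H"
    and "F = shrinking H (low_vertices P L H)" and "verts F \<noteq> {}"
    and "block F B"
  shows "brick B \<or> (B \<in> minimal_forbidden P \<and> regular r B) \<or> (B \<in> P \<and> max_degree B \<le> r)"
proof -
  define X where "X = low_vertices P L H"
  have P: "hereditary P" using assms(1) by (simp add: smooth_def)
  note H = assms(3)
  have no: "\<not> (\<exists>\<chi>. list_coloring P C L H \<chi>)"
    and crit: "\<And>v. v \<in> verts H \<Longrightarrow> \<exists>\<phi>. list_coloring P C L (del_vert H v) \<phi>"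
    using assms(6) by (auto simp: list_critical_def)
  have XH: "X \<subseteq> verts H" by (auto simp: X_def low_vertices_def)
  have F: "verts F = X" "edges F = {e \<in> edges H. card (inc H e \<inter> X) \<ge> 2}"
    "\<And>e. inc F e = inc H e \<inter> X"
    using assms(7) by (simp_all add: shrinking_def X_def)
  have hypF: "hypergraph F"
    using H XH finite_subset by (auto simp: hypergraph_def F)
  have hypB: "hypergraph B" and B: "verts B \<subseteq> X" "edges B \<subseteq> edges F"
    "\<And>e. e \<in> edges B \<Longrightarrow> inc B e = inc H e \<inter> X" and cn: "connected_nonseparable B"
  proof -
    have "subhypergraph B F \<and> connected_nonseparable B"
      using assms(9) unfolding block_def by blast
    then show "hypergraph B" "verts B \<subseteq> X" "edges B \<subseteq> edges F" "connected_nonseparable B"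
      "\<And>e. e \<in> edges B \<Longrightarrow> inc B e = inc H e \<inter> X"
      unfolding subhypergraph_def by (simp_all add: F(1,3))
  qed
  have EB: "edges B \<subseteq> edges H" using B(2) by (auto simp: F)
  have conn: "hyper_connected B" using cn by (simp add: connected_nonseparable_def)
  have L: "L v \<subseteq> C" if "v \<in> X" for v
    using assms(5) that XH by (auto simp: list_assignment_def)
  \<comment> \<open>An edge of \<open>H\<close> with two vertices in \<open>B\<close> survives in
    \<open>F\<close> and then belongs to \<open>B\<close> by \<open>block_edge\<close>.\<close>
  have outside: "w \<notin> verts B" if "v \<in> verts B" "e \<in> edges H" "e \<notin> edges B" "v \<in> inc H e"
    "w \<in> inc H e" "w \<noteq> v" for v w e
  proof
    assume w: "w \<in> verts B"
    have vw: "{v, w} \<subseteq> inc H e \<inter> X" using that w B(1) by auto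
    have "finite (inc H e \<inter> X)"
      using H that(2) finite_subset by (auto simp: hypergraph_def)
    from card_mono[OF this vw] have "e \<in> edges F" using that by (auto simp: F)
    then have "e \<in> edges B"
      using block_edge[OF hypF assms(9), of e v w] vw that(1,6) w by (auto simp: F(3))
    then show False using that by simp
  qed
  have "brick B \<or> (\<forall>v\<in>verts B. degree B v \<le> r)"
  proof (cases "verts B = {}")
    case False
    then obtain v0 where v0: "v0 \<in> verts B" by blast
    then obtain \<phi>0 where \<phi>0: "list_coloring P C L (del_vert H v0) \<phi>0"
      using crit B(1) XH by blast
    \<comment> \<open>All states agree with one fixed coloring outside \<open>B\<close>, which is
      what makes the counts inside \<open>B\<close> depend on the hole only.\<close>
    define St where "St v \<phi> \<longleftrightarrow> v \<in> verts B \<and> list_coloring P C L (del_vert H v) \<phi> \<and>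
      (\<forall>w. w \<notin> verts B \<longrightarrow> \<phi> w = \<phi>0 w)" for v \<phi>
    have low: "\<And>c. c \<in> L v \<Longrightarrow> card (mono_edges H v \<phi> c) = r"
      "\<And>e. e \<in> edges H \<Longrightarrow> v \<in> inc H e \<Longrightarrow> \<exists>c\<in>L v. e \<in> mono_edges H v \<phi> c" if "St v \<phi>" for v \<phi>
      using low_vertex_edges[OF P H no, of v \<phi>] that B(1) L assms(2)
      unfolding St_def X_def by blast+
    \<comment> \<open>By \<open>outside\<close>, the vertices other than \<open>v\<close> of such an
      edge lie outside \<open>B\<close>, so its color is given by \<open>\<phi>0\<close> in every
      state.\<close>
    define outer where "outer v c = {e \<in> edges H. v \<in> inc H e \<and> e \<notin> edges B \<and> (\<forall>u\<in>inc H e - {v}. \<phi>0 u = c)}"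
      for v c
    have incB: "inc B e \<subseteq> inc H e" if "e \<in> edges B" for e using B(3)[OF that] by blast
    \<comment> \<open>For \<open>c\<close> in \<open>L v\<close> the \<open>r\<close> edges of color
      \<open>c\<close> at \<open>v\<close> split into those of \<open>B\<close> and the outer ones,
      so the subtraction is exact. Every edge at \<open>v\<close> has a color from
      \<open>L v\<close>, whence 0 otherwise.\<close>
    have card: "card (colored_edges B v \<phi> c) = (if c \<in> L v then r - card (outer v c) else 0)"
      if St: "St v \<phi>" for v \<phi> c
    proof -
      have v: "v \<in> verts B" and out: "\<And>w. w \<notin> verts B \<Longrightarrow> \<phi> w = \<phi>0 w"
        using St by (auto simp: St_def)
      have vX: "v \<in> X" using v B(1) by blast
      have col: "e \<in> mono_edges H v \<phi> c \<and> c \<in> L v" if e: "e \<in> colored_edges B v \<phi> c" for e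
      proof -
        obtain u where u: "e \<in> edges B" "v \<in> inc B e" "u \<in> inc B e" "u \<noteq> v" "\<phi> u = c"
          using e by (auto simp: colored_edges_def)
        then obtain d where d: "d \<in> L v" "e \<in> mono_edges H v \<phi> d"
          using low(2)[OF St, of e] EB incB by blast
        have "u \<in> inc H e - {v}" using u incB by blast
        then have "d = c" using d(2) u(5) by (auto simp: mono_edges_def)
        then show ?thesis using d by simp
      qed
      show ?thesis
      proof (cases "c \<in> L v")
        case True
        have "mono_edges H v \<phi> c = colored_edges B v \<phi> c \<union> outer v c"
        proof (intro set_eqI iffI)
          fix e assume e: "e \<in> mono_edges H v \<phi> c"
          then have e': "e \<in> edges H" "v \<in> inc H e" "\<forall>u\<in>inc H e - {v}. \<phi> u = c"
            by (auto simp: mono_edges_def)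
          show "e \<in> colored_edges B v \<phi> c \<union> outer v c"
          proof (cases "e \<in> edges B")
            case True
            then obtain u where "u \<in> inc B e" "u \<noteq> v" using edge_other_vertex[OF hypB] by blast
            moreover have "v \<in> inc B e" using B(3)[OF True] e'(2) vX by blast
            ultimately have "e \<in> colored_edges B v \<phi> c"
              using True e'(3) incB[OF True] by (auto simp: colored_edges_def)
            then show ?thesis by blast
          next
            case False
            then have "\<forall>u\<in>inc H e - {v}. \<phi>0 u = c"
              using outside[OF v e'(1) False e'(2)] out e'(3) by auto
            then show ?thesis using e' False by (auto simp: outer_def)
          qed
        next
          fix e assume "e \<in> colored_edges B v \<phi> c \<union> outer v c"
          then show "e \<in> mono_edges H v \<phi> c"
          proof
            assume "e \<in> outer v c"
            then have e: "e \<in> edges H" "v \<in> inc H e" "e \<notin> edges B" "\<forall>u\<in>inc H e - {v}. \<phi>0 u = c"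
              by (auto simp: outer_def)
            then have "\<forall>u\<in>inc H e - {v}. \<phi> u = c"
              using outside[OF v e(1,3,2)] out by auto
            then show ?thesis using e by (auto simp: mono_edges_def)
          qed (use col in blast)
        qed
        moreover have "colored_edges B v \<phi> c \<inter> outer v c = {}"
          by (auto simp: colored_edges_def outer_def)
        moreover have "finite (outer v c)" "finite (colored_edges B v \<phi> c)"
          using H hypB by (auto simp: outer_def colored_edges_def hypergraph_def)
        ultimately have "r = card (colored_edges B v \<phi> c) + card (outer v c)"
          using low(1)[OF St True] by (simp add: card_Un_disjoint)
        then show ?thesis using True by simp
      next
        case False
        then have "colored_edges B v \<phi> c = {}" using col by blast
        then show ?thesis using False by simp
      qed
    qed
    interpret hole_system B St r
    proof
      show "hypergraph B" by (rule hypB)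
      show "(adj B)\<^sup>*\<^sup>* u w" if "u \<in> verts B" "w \<in> verts B" for u w
        using conn that hyper_connected_iff[OF hypB] by blast
      show "(adj_avoiding B x)\<^sup>*\<^sup>* u w"
        if "x \<in> verts B" "u \<in> verts B" "w \<in> verts B" "u \<noteq> x" "w \<noteq> x" for x u w
        by (rule connected_nonseparable_avoiding[OF hypB cn that])
      show "\<phi> u = \<phi> w" if St: "St v \<phi>" and e: "e \<in> edges B" "v \<in> inc B e" "u \<in> inc B e" "w \<in> inc B e"
        "u \<noteq> v" "w \<noteq> v" for v \<phi> e u w
      proof -
        have i: "v \<in> inc H e" "u \<in> inc H e - {v}" "w \<in> inc H e - {v}" "e \<in> edges H"
          using e incB EB by blast+
        then obtain c where "e \<in> mono_edges H v \<phi> c" using low(2)[OF St] by blast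
        then show ?thesis using i by (simp add: mono_edges_def)
      qed
      show "card (colored_edges B v \<phi> c) = card (colored_edges B v \<psi> c)"
        if "St v \<phi>" "St v \<psi>" for v \<phi> \<psi> c
        using card that by simp
      show "card (colored_edges B v \<phi> c) \<le> r" if "St v \<phi>" for v \<phi> c
        using card[OF that] by simp
      \<comment> \<open>Both ends of the shift lie in \<open>B\<close>, so the colors outside
        \<open>B\<close> are kept.\<close>
      show "St u (\<phi>(v := \<phi> u))" if St: "St v \<phi>" and u: "adj B v u" for v \<phi> u
      proof -
        have "adj H v u" using u incB EB unfolding adj_def by blast
        moreover have "u \<in> verts B" "v \<in> verts B" using adj_verts[OF hypB u] by auto
        moreover from this have "v \<in> X" using B(1) by blast
        ultimately show ?thesis
          using shift_coloring[OF P H no, of v \<phi> u] St L unfolding St_def X_def by auto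
      qed
    qed
    have "St v0 \<phi>0" using v0 \<phi>0 by (simp add: St_def)
    then show ?thesis using brick_or_degree_le v0 by blast
  qed simp
  then show ?thesis
    using connected_degree_le[OF assms(1) hypB conn] assms(2) by blast
qed

end
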